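(* Let $X=(x_0,x_1)$ be a bounded interval and fix $\xi\in\mathbb{D}$. Let $\zeta,\zeta_n\in\mathrm{Reg}_+(X)$ $(n\ge1)$, set $\Sigma=\Sigma_\zeta\cup\bigcup_{n=1}^\infty\Sigma_{\zeta_n}$, and fix $\omega\in\mathbb{R}\setminus\Sigma$. If $\zeta_n\to\zeta$ uniformly, then $\psi_{\zeta_n}\to\psi_\zeta$ in $W^{1,2}(X)$. If in addition each $\psi_{\zeta_n}$ satisfies the boundary conditions $$u^{\rm r}(x_0+)=1\quad\text{and}\quad u^{\ell}(x_1-)=\xi\,u^{\rm r}(x_1-)$$ (with $u=\psi_{\zeta_n}$), then $\psi_\zeta$ also satisfies these boundary conditions (with $u=\psi_\zeta$), and moreover $\psi_{\zeta_n}^{\ell}\to\psi_\zeta^{\ell}$ and $\psi_{\zeta_n}^{\rm r}\to\psi_\zeta^{\rm r}$ uniformly.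
   Context: $\mathbb{D}$ is the open unit disk. $\mathrm{Reg}(X)$ is the closure in $L^\infty(X)$ of the piecewise-constant complex-valued functions with finitely many discontinuities; $\mathrm{Reg}_+(X)=\{f\in\mathrm{Reg}(X):\exists\varepsilon>0,\ f>\varepsilon\text{ on }X\}$. Uniform convergence is convergence in $L^\infty(X)$. One-sided limits are written $f(x\pm)$. For $\omega\ne0$: $u^{\ell}=\frac12\bigl(u-\frac1{i\omega}u'\bigr)$, $u^{\rm r}=\frac12\bigl(u+\frac1{i\omega}u'\bigr)$. Exceptional set: let $A_{\zeta,0}:L^2(X)\to L^2(X)$ be the compact operator that sends $\psi$ to the unique $A_{\zeta,0}\psi\in W^{1,2}(X)$ such that $\langle\zeta A_{\zeta,0}\psi,v\rangle_{L^2}+\langle\zeta (A_{\zeta,0}\psi)',v'\rangle_{L^2}=\langle\zeta\psi,v\rangle_{L^2}$ for all $v\in W^{1,2}(X)$; then $\Sigma_\zeta=\{\pm\sqrt{\lambda^{-1}-1}:\lambda\in\operatorname{spec}A_{\zeta,0}\cap(0,1]\}$, a countable set containing $0$. Weak solution: write $\frac{1-\xi}{1+\xi}=\nu+i\eta$ with $\nu>0$, $\eta\in\mathbb{R}$. For $\zeta\in\mathrm{Reg}_+(X)$ and $\omega\in\mathbb{R}\setminus\Sigma_\zeta$, $\psi_\zeta\in W^{1,2}(X)$ denotes the unique solution (which is known to exist) $\psi$ of $$\omega^2\langle\zeta\psi,v\rangle_{L^2}-\langle\zeta\psi',v'\rangle_{L^2}+i\omega\bigl(\zeta(x_0+)\psi(x_0+)\overline{v}(x_0+)+\zeta(x_1-)(\nu+i\eta)\psi(x_1-)\overline{v}(x_1-)\bigr)=2i\omega\,\zeta(x_0+)\overline{v}(x_0+)$$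 for all $v\in W^{1,2}(X)$. It depends on $\omega$ and $\xi$, which are fixed. *)

theory Defs
  imports "HOL-Analysis.Analysis" "HOL-Probability.Essential_Supremum"
begin

(* Elements of Lebesgue and Sobolev spaces are represented by functions on the real line, of which
   only the values almost everywhere on X (for one-sided limits: near the endpoint) matter. *)

section \<open>Lebesgue spaces\<close>

definition L2 :: "real set \<Rightarrow> (real \<Rightarrow> complex) set" where
  "L2 X = {f. f \<in> borel_measurable (lebesgue_on X) \<and>
              integrable (lebesgue_on X) (\<lambda>x. (cmod (f x))\<^sup>2)}"

definition inner_L2 :: "real set \<Rightarrow> (real \<Rightarrow> complex) \<Rightarrow> (real \<Rightarrow> complex) \<Rightarrow> complex" where
  "inner_L2 X f g = (LINT x|lebesgue_on X. f x * cnj (g x))"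

definition norm_L2 :: "real set \<Rightarrow> (real \<Rightarrow> complex) \<Rightarrow> real" where
  "norm_L2 X f = sqrt (LINT x|lebesgue_on X. (cmod (f x))\<^sup>2)"

definition norm_Linf :: "real set \<Rightarrow> (real \<Rightarrow> complex) \<Rightarrow> ereal" where
  "norm_Linf X f = esssup (lebesgue_on X) (\<lambda>x. ereal (cmod (f x)))"

definition Linf :: "real set \<Rightarrow> (real \<Rightarrow> complex) set" where
  "Linf X = {f. f \<in> borel_measurable (lebesgue_on X) \<and> norm_Linf X f < \<infinity>}"

definition tendsto_Linf :: "real set \<Rightarrow> (nat \<Rightarrow> real \<Rightarrow> complex) \<Rightarrow> (real \<Rightarrow> complex) \<Rightarrow> bool" where
  "tendsto_Linf X f g \<longleftrightarrow> (\<forall>n. f n \<in> Linf X) \<and> g \<in> Linf X \<and>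
     (\<lambda>n. norm_Linf X (\<lambda>x. f n x - g x)) \<longlonglongrightarrow> 0"


section \<open>One-sided limits of almost-everywhere classes\<close>

(* One-sided limits that ignore null sets.  For the continuous representative of a Sobolev
   function, and for a regulated function, these are the ordinary one-sided limits. *)

definition ess_at_right :: "real \<Rightarrow> real filter" where
  "ess_at_right a = inf (at_right a) (ae_filter lebesgue)"

definition ess_at_left :: "real \<Rightarrow> real filter" where
  "ess_at_left a = inf (at_left a) (ae_filter lebesgue)"

lemma eventually_ess_at_right:
  "eventually P (ess_at_right a) \<longleftrightarrow> (\<exists>b>a. AE x in lebesgue. a < x \<and> x < b \<longrightarrow> P x)"
proof
  assume "eventually P (ess_at_right a)"
  then obtain Q R where Q: "eventually Q (at_right a)" and R: "AE x in lebesgue. R x"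
    and QR: "\<forall>x. Q x \<and> R x \<longrightarrow> P x"
    unfolding ess_at_right_def eventually_inf by blast
  from Q obtain b where b: "b > a" "\<And>x. a < x \<Longrightarrow> x < b \<Longrightarrow> Q x"
    unfolding eventually_at_right_field by blast
  have "AE x in lebesgue. a < x \<and> x < b \<longrightarrow> P x"
    using R by eventually_elim (use b QR in blast)
  with b show "\<exists>b>a. AE x in lebesgue. a < x \<and> x < b \<longrightarrow> P x" by blast
next
  assume "\<exists>b>a. AE x in lebesgue. a < x \<and> x < b \<longrightarrow> P x"
  then obtain b where b: "b > a" "AE x in lebesgue. a < x \<and> x < b \<longrightarrow> P x" by blast
  have "eventually (\<lambda>x. a < x \<and> x < b) (at_right a)"
    using b(1) unfolding eventually_at_right_field by blast
  with b(2) show "eventually P (ess_at_right a)"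
    unfolding ess_at_right_def eventually_inf by blast
qed

lemma eventually_ess_at_left:
  "eventually P (ess_at_left a) \<longleftrightarrow> (\<exists>b<a. AE x in lebesgue. b < x \<and> x < a \<longrightarrow> P x)"
proof
  assume "eventually P (ess_at_left a)"
  then obtain Q R where Q: "eventually Q (at_left a)" and R: "AE x in lebesgue. R x"
    and QR: "\<forall>x. Q x \<and> R x \<longrightarrow> P x"
    unfolding ess_at_left_def eventually_inf by blast
  from Q obtain b where b: "b < a" "\<And>x. b < x \<Longrightarrow> x < a \<Longrightarrow> Q x"
    unfolding eventually_at_left_field by blast
  have "AE x in lebesgue. b < x \<and> x < a \<longrightarrow> P x"
    using R by eventually_elim (use b QR in blast)
  with b show "\<exists>b<a. AE x in lebesgue. b < x \<and> x < a \<longrightarrow> P x" by blast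
next
  assume "\<exists>b<a. AE x in lebesgue. b < x \<and> x < a \<longrightarrow> P x"
  then obtain b where b: "b < a" "AE x in lebesgue. b < x \<and> x < a \<longrightarrow> P x" by blast
  have "eventually (\<lambda>x. b < x \<and> x < a) (at_left a)"
    using b(1) unfolding eventually_at_left_field by blast
  with b(2) show "eventually P (ess_at_left a)"
    unfolding ess_at_left_def eventually_inf by blast
qed

definition rlim :: "(real \<Rightarrow> complex) \<Rightarrow> real \<Rightarrow> complex" where
  "rlim f a = Lim (ess_at_right a) f"

definition llim :: "(real \<Rightarrow> complex) \<Rightarrow> real \<Rightarrow> complex" where
  "llim f a = Lim (ess_at_left a) f"


section \<open>Regulated functions\<close>

definition piecewise_constant :: "real set \<Rightarrow> (real \<Rightarrow> complex) set" where
  "piecewise_constant X = {s. \<exists>F. finite F \<and>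
     (\<forall>x\<in>X. \<forall>y\<in>X. x \<le> y \<and> {x..y} \<inter> F = {} \<longrightarrow> s x = s y)}"

definition Reg :: "real set \<Rightarrow> (real \<Rightarrow> complex) set" where
  "Reg X = {f \<in> Linf X. \<forall>\<epsilon>>0. \<exists>s\<in>piecewise_constant X. norm_Linf X (\<lambda>x. f x - s x) < ereal \<epsilon>}"

definition Reg_pos :: "real set \<Rightarrow> (real \<Rightarrow> complex) set" where
  "Reg_pos X = {f \<in> Reg X. \<exists>\<epsilon>>0. AE x in lebesgue_on X. f x \<in> \<real> \<and> Re (f x) > \<epsilon>}"


section \<open>The Sobolev space\<close>

(* Weak derivative, tested against continuously differentiable functions with compact support
   in X.  By mollification, smooth test functions give the same notion. *)
definition weak_deriv :: "real set \<Rightarrow> (real \<Rightarrow> complex) \<Rightarrow> (real \<Rightarrow> complex) \<Rightarrow> bool" where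
  "weak_deriv X u g \<longleftrightarrow>
     (\<forall>\<phi> \<phi>' :: real \<Rightarrow> complex.
        (\<forall>x. (\<phi> has_vector_derivative \<phi>' x) (at x)) \<and> continuous_on UNIV \<phi>' \<and>
        (\<exists>K. compact K \<and> K \<subseteq> X \<and> (\<forall>x. x \<notin> K \<longrightarrow> \<phi> x = 0)) \<longrightarrow>
        (LINT x|lebesgue_on X. u x * \<phi>' x) = - (LINT x|lebesgue_on X. g x * \<phi> x))"

definition W12 :: "real set \<Rightarrow> (real \<Rightarrow> complex) set" where
  "W12 X = {u \<in> L2 X. \<exists>g\<in>L2 X. weak_deriv X u g}"

(* Unique up to a null set, for u in W12 X. *)
definition wderiv :: "real set \<Rightarrow> (real \<Rightarrow> complex) \<Rightarrow> real \<Rightarrow> complex" where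
  "wderiv X u = (SOME g. g \<in> L2 X \<and> weak_deriv X u g)"

definition norm_W12 :: "real set \<Rightarrow> (real \<Rightarrow> complex) \<Rightarrow> real" where
  "norm_W12 X u = sqrt ((norm_L2 X u)\<^sup>2 + (norm_L2 X (wderiv X u))\<^sup>2)"

definition tendsto_W12 :: "real set \<Rightarrow> (nat \<Rightarrow> real \<Rightarrow> complex) \<Rightarrow> (real \<Rightarrow> complex) \<Rightarrow> bool" where
  "tendsto_W12 X f g \<longleftrightarrow> (\<forall>n. f n \<in> W12 X) \<and> g \<in> W12 X \<and>
     (\<lambda>n. norm_W12 X (\<lambda>x. f n x - g x)) \<longlonglongrightarrow> 0"


section \<open>The exceptional set\<close>

(* The defining property determines the value up to a null set, and depends on the argument
   only up to a null set. *)
definition A0 :: "real set \<Rightarrow> (real \<Rightarrow> complex) \<Rightarrow> (real \<Rightarrow> complex) \<Rightarrow> (real \<Rightarrow> complex)" where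
  "A0 X \<zeta> \<psi> = (SOME \<phi>. \<phi> \<in> W12 X \<and>
     (\<forall>v\<in>W12 X. inner_L2 X (\<lambda>x. \<zeta> x * \<phi> x) v + inner_L2 X (\<lambda>x. \<zeta> x * wderiv X \<phi> x) (wderiv X v)
              = inner_L2 X (\<lambda>x. \<zeta> x * \<psi> x) v))"

(* The spectrum of a linear operator on L^2: those numbers for which T - l is not a bijection
   (modulo null sets) with bounded inverse.  The lower bound includes injectivity. *)
definition spectrum_L2 :: "real set \<Rightarrow> ((real \<Rightarrow> complex) \<Rightarrow> (real \<Rightarrow> complex)) \<Rightarrow> complex set" where
  "spectrum_L2 X T = {l. \<not> (
     (\<forall>f\<in>L2 X. \<exists>\<psi>\<in>L2 X. AE x in lebesgue_on X. T \<psi> x - l * \<psi> x = f x) \<and>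
     (\<exists>C. \<forall>\<psi>\<in>L2 X. norm_L2 X \<psi> \<le> C * norm_L2 X (\<lambda>x. T \<psi> x - l * \<psi> x)))}"

definition exceptional_set :: "real set \<Rightarrow> (real \<Rightarrow> complex) \<Rightarrow> real set" where
  "exceptional_set X \<zeta> = {s. \<exists>l::real. complex_of_real l \<in> spectrum_L2 X (A0 X \<zeta>) \<and> 0 < l \<and> l \<le> 1 \<and>
     (s = sqrt (inverse l - 1) \<or> s = - sqrt (inverse l - 1))}"


section \<open>Weak solutions and boundary conditions\<close>

(* The factor (1 - \<xi>) / (1 + \<xi>) is the number usually split as \<nu> + i \<eta>, with \<nu> > 0 for
   \<xi> in the open unit disk. *)
definition weak_solution ::
  "real \<Rightarrow> real \<Rightarrow> complex \<Rightarrow> real \<Rightarrow> (real \<Rightarrow> complex) \<Rightarrow> (real \<Rightarrow> complex) \<Rightarrow> bool" where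
  "weak_solution x0 x1 \<xi> \<omega> \<zeta> \<psi> \<longleftrightarrow>
     (let X = {x0<..<x1}; w = complex_of_real \<omega> in
      \<psi> \<in> W12 X \<and>
      (\<forall>v\<in>W12 X.
         w\<^sup>2 * inner_L2 X (\<lambda>x. \<zeta> x * \<psi> x) v
         - inner_L2 X (\<lambda>x. \<zeta> x * wderiv X \<psi> x) (wderiv X v)
         + \<i> * w * (rlim \<zeta> x0 * rlim \<psi> x0 * cnj (rlim v x0)
                  + llim \<zeta> x1 * ((1 - \<xi>) / (1 + \<xi>)) * llim \<psi> x1 * cnj (llim v x1))
         = 2 * \<i> * w * rlim \<zeta> x0 * cnj (rlim v x0)))"

definition left_part :: "real set \<Rightarrow> real \<Rightarrow> (real \<Rightarrow> complex) \<Rightarrow> real \<Rightarrow> complex" where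
  "left_part X \<omega> u x = (u x - 1 / (\<i> * complex_of_real \<omega>) * wderiv X u x) / 2"

definition right_part :: "real set \<Rightarrow> real \<Rightarrow> (real \<Rightarrow> complex) \<Rightarrow> real \<Rightarrow> complex" where
  "right_part X \<omega> u x = (u x + 1 / (\<i> * complex_of_real \<omega>) * wderiv X u x) / 2"

(* The existence of the one-sided limits is part of the boundary conditions, since the derivative
   of a general Sobolev function has none. *)
definition boundary_conditions ::
  "real \<Rightarrow> real \<Rightarrow> complex \<Rightarrow> real \<Rightarrow> (real \<Rightarrow> complex) \<Rightarrow> bool" where
  "boundary_conditions x0 x1 \<xi> \<omega> u \<longleftrightarrow>
     (let X = {x0<..<x1} in
      (right_part X \<omega> u \<longlongrightarrow> 1) (ess_at_right x0) \<and>
      (\<exists>r. (right_part X \<omega> u \<longlongrightarrow> r) (ess_at_left x1) \<and>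
           (left_part X \<omega> u \<longlongrightarrow> \<xi> * r) (ess_at_left x1)))"

end

theory Submission
  imports Defs
begin

text \<open>
  The flux $P = \zeta\psi'$ of a weak solution turns the equation into the first-order system
  $\psi' = P/\zeta$, $P' = -\omega^2\zeta\psi$. Testing with the ramps $v(t) = (a-t)^+$ and with
  $v = 1$ gives $P(x) = i\omega\zeta(x_0+)(2-\psi(x_0)) - \omega^2\int_{x_0}^x\zeta\psi$ and
  $P(x_1) = i\omega\zeta(x_1-)\frac{1-\xi}{1+\xi}\psi(x_1)$; since $\zeta$ has one-sided limits,
  these are exactly the boundary conditions.

  For stability, let $d = \psi_n-\psi$, let $q$ be the difference of the fluxes,
  $\varepsilon = \|\zeta_n-\zeta\|_\infty$ and $S = \sup(|d|+|q|)$. The imaginary part of the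
  difference of the weak equations tested with $v = d$ leaves only boundary terms on one side, and
  as $\mathrm{Re}\,\frac{1-\xi}{1+\xi} > 0$ they have the same sign, so
  $|d(x_0)|^2 \le C\varepsilon(S+\varepsilon)$. Gronwall's inequality for the first-order system gives
  $S \le C(|d(x_0)|+\varepsilon)$, and together $S \le C\varepsilon$. The constants contain
  $1/\omega$, which is harmless because $0$ belongs to the exceptional set.
\<close>

section \<open>Square integrable functions on a bounded interval\<close>

text \<open>The interior part of the form, with its two volume terms of opposite sign, is
  indefinite, so testing with the difference of two solutions gives no interior bound. It is however
  real, which is why taking the imaginary part isolates the endpoints. Control at \<open>x0\<close>
  alone is enough: the weak equation ties the initial flux to the initial value there, and the
  first-order system propagates both. The flux replaces the derivative because
  \<open>\<zeta>\<close> may jump: then the derivative jumps as well, while the flux has a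
  continuous representative to which a sup norm and Gronwall apply. Constants must not depend on the
  member of the sequence. Every difference of products is therefore split so that the error in the
  coefficient multiplies the limit solution, and only sup bounds of that one solution occur. Since
  \<open>wderiv\<close> is an arbitrary choice and Sobolev functions are classes, all computations
  use pairs of an initial value and a derivative; the lemma of du Bois-Reymond provides
  them.\<close>

locale bounded_interval =
  fixes x0 x1 :: real
  assumes x0_less_x1: "x0 < x1"
begin

abbreviation X :: "real set" where "X \<equiv> {x0<..<x1}"

abbreviation M :: "real measure" where "M \<equiv> lebesgue_on {x0<..<x1}"

text \<open>The gauge integral brings continuity and differentiation of primitives.
  \<open>prim_eq_lebesgue\<close> links it to the Lebesgue integral, where almost-everywhere
  arguments, Fubini and dominated convergence take place.\<close>

abbreviation prim :: "(real \<Rightarrow> complex) \<Rightarrow> real \<Rightarrow> complex" where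
  "prim f s \<equiv> integral {x0..s} f"

sublocale finite_measure "lebesgue_on {x0<..<x1}"
  by (rule finite_measure_lebesgue_on) simp

sublocale pair: pair_sigma_finite "lebesgue_on {x0<..<x1}" "lebesgue_on {x0<..<x1}"
  by unfold_locales

lemma AE_M_iff: "(AE x in M. P x) \<longleftrightarrow> (AE x in lebesgue. x0 < x \<and> x < x1 \<longrightarrow> P x)"
  by (simp add: AE_restrict_space_iff)

lemma measurable_id_M [measurable]: "(\<lambda>x. x) \<in> borel_measurable M"
  by (intro measurable_restrict_space1 measurable_completion) simp

lemma measurable_continuous_M:
  "continuous_on {x0..x1} (f :: real \<Rightarrow> 'b::euclidean_space) \<Longrightarrow> f \<in> borel_measurable M"
  by (intro continuous_imp_measurable_on_sets_lebesgue) (auto elim: continuous_on_subset)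

lemma L2_measurable: "f \<in> L2 X \<Longrightarrow> f \<in> borel_measurable M"
  by (simp add: L2_def)

lemma L2_square: "f \<in> L2 X \<Longrightarrow> integrable M (\<lambda>x. (cmod (f x))\<^sup>2)"
  by (simp add: L2_def)

lemma bounded_integrable:
  fixes f :: "real \<Rightarrow> 'b::{banach, second_countable_topology}"
  assumes "f \<in> borel_measurable M" "AE x in M. norm (f x) \<le> B"
  shows "integrable M f"
  using assms by (intro integrable_const_bound) auto

lemma L2_mult:
  assumes "f \<in> L2 X" "g \<in> L2 X"
  shows "integrable M (\<lambda>x. f x * g x)"
proof (rule Bochner_Integration.integrable_bound)
  show "integrable M (\<lambda>x. (cmod (f x))\<^sup>2 + (cmod (g x))\<^sup>2)"
    using assms by (simp add: L2_square)
  show "(\<lambda>x. f x * g x) \<in> borel_measurable M"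
    using assms[THEN L2_measurable] by simp
  have "a * b \<le> a\<^sup>2 + b\<^sup>2" if "a \<ge> 0" "b \<ge> 0" for a b :: real
    using sum_squares_bound[of a b] mult_nonneg_nonneg[OF that] by simp
  then show "AE x in M. norm (f x * g x) \<le> norm ((cmod (f x))\<^sup>2 + (cmod (g x))\<^sup>2)"
    by (simp add: norm_mult)
qed

lemma L2_cnj:
  assumes "f \<in> L2 X" shows "(\<lambda>x. cnj (f x)) \<in> L2 X"
proof -
  have "(\<lambda>x. cnj (f x)) \<in> borel_measurable M"
    using assms by (intro measurable_compose[OF L2_measurable borel_measurable_continuous_onI]) (auto intro: continuous_intros)
  then show ?thesis using assms by (simp add: L2_def)
qed

lemma bounded_L2:
  assumes "f \<in> borel_measurable M" "AE x in M. cmod (f x) \<le> B"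
  shows "f \<in> L2 X"
  unfolding L2_def
proof (safe)
  show "f \<in> borel_measurable M" by fact
  show "integrable M (\<lambda>x. (cmod (f x))\<^sup>2)"
  proof (rule bounded_integrable[of _ "B\<^sup>2"])
    show "AE x in M. norm ((cmod (f x))\<^sup>2) \<le> B\<^sup>2"
      using assms(2) by eventually_elim (auto intro!: power_mono)
  qed (use assms(1) in measurable)
qed

lemma const_L2: "(\<lambda>x. c) \<in> L2 X"
  by (rule bounded_L2[of _ "cmod c"]) auto

lemma L2_integrable: "f \<in> L2 X \<Longrightarrow> integrable M f"
  using L2_mult[OF const_L2[of 1], of f] by simp

lemma L2_bounded_mult:
  assumes [measurable]: "h \<in> borel_measurable M" and h: "AE x in M. cmod (h x) \<le> B" and f: "f \<in> L2 X"
  shows "(\<lambda>x. h x * f x) \<in> L2 X"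
  unfolding L2_def
proof safe
  note [measurable] = L2_measurable[OF f]
  show "(\<lambda>x. h x * f x) \<in> borel_measurable M" by measurable
  show "integrable M (\<lambda>x. (cmod (h x * f x))\<^sup>2)"
  proof (rule Bochner_Integration.integrable_bound)
    show "integrable M (\<lambda>x. B\<^sup>2 * (cmod (f x))\<^sup>2)" using f by (simp add: L2_square)
    show "AE x in M. norm ((cmod (h x * f x))\<^sup>2) \<le> norm (B\<^sup>2 * (cmod (f x))\<^sup>2)"
      using h by eventually_elim (auto simp: norm_mult power_mult_distrib intro!: mult_right_mono power_mono)
  qed measurable
qed

lemma L2_diff:
  assumes "f \<in> L2 X" "g \<in> L2 X"
  shows "(\<lambda>x. f x - g x) \<in> L2 X"
  unfolding L2_def
proof safe
  note [measurable] = assms[THEN L2_measurable]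
  show "(\<lambda>x. f x - g x) \<in> borel_measurable M" by measurable
  show "integrable M (\<lambda>x. (cmod (f x - g x))\<^sup>2)"
  proof (rule Bochner_Integration.integrable_bound)
    show "integrable M (\<lambda>x. 2 * (cmod (f x))\<^sup>2 + 2 * (cmod (g x))\<^sup>2)"
      using assms by (simp add: L2_square)
    have "(cmod (a - b))\<^sup>2 \<le> 2 * (cmod a)\<^sup>2 + 2 * (cmod b)\<^sup>2" for a b
    proof -
      have "(cmod (a - b))\<^sup>2 \<le> (cmod a + cmod b)\<^sup>2" by (intro power_mono norm_triangle_ineq4) auto
      also have "\<dots> \<le> 2 * (cmod a)\<^sup>2 + 2 * (cmod b)\<^sup>2"
        using sum_squares_bound[of "cmod a" "cmod b"] by (simp add: power2_sum)
      finally show ?thesis .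
    qed
    then show "AE x in M. norm ((cmod (f x - g x))\<^sup>2) \<le> norm (2 * (cmod (f x))\<^sup>2 + 2 * (cmod (g x))\<^sup>2)"
      by simp
  qed measurable
qed

lemma L2_AE_cong:
  assumes "f \<in> L2 X" "g \<in> borel_measurable M" "AE x in M. f x = g x"
  shows "g \<in> L2 X"
proof -
  have "integrable M (\<lambda>x. (cmod (g x))\<^sup>2)"
  proof (rule iffD1[OF integrable_cong_AE L2_square[OF assms(1)]])
    show "AE x in M. (cmod (f x))\<^sup>2 = (cmod (g x))\<^sup>2" using assms(3) by eventually_elim simp
  qed (use assms L2_measurable[OF assms(1)] in measurable)
  with assms(2) show ?thesis by (simp add: L2_def)
qed

section \<open>Primitives and the lemma of du Bois-Reymond\<close>

lemma integrable_cut: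
  fixes f :: "real \<Rightarrow> 'b::{banach, second_countable_topology}"
  assumes f: "integrable M f"
  shows "integrable M (\<lambda>t. if t < s then f t else 0)"
proof (rule Bochner_Integration.integrable_bound[OF f])
  note [measurable] = borel_measurable_integrable[OF f]
  show "(\<lambda>t. if t < s then f t else 0) \<in> borel_measurable M" by measurable
qed auto

lemma integrable_on_X:
  fixes f :: "real \<Rightarrow> 'b::euclidean_space"
  assumes "integrable M f"
  shows "f integrable_on {x0..x1}"
  using integrable_on_lebesgue_on[OF assms] integrable_on_open_interval_real[of f x0 x1] by simp

lemma integrable_on_sub:
  fixes f :: "real \<Rightarrow> 'b::euclidean_space"
  assumes "integrable M f" "x0 \<le> a" "b \<le> x1"
  shows "f integrable_on {a..b}"
  using assms by (intro integrable_on_subinterval[OF integrable_on_X[OF assms(1)]]) auto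

text \<open>Truncating the integrand instead of shrinking the domain keeps the measure
  \<open>M\<close> fixed, as an exchange of integrations or a dominated limit requires. For
  \<open>s \<le> x0\<close> both sides vanish.\<close>

lemma prim_eq_lebesgue:
  fixes f :: "real \<Rightarrow> 'b::euclidean_space"
  assumes "integrable M f" "s \<le> x1"
  shows "integral {x0..s} f = (LINT t|M. (if t < s then f t else 0))"
proof -
  have "(LINT t|M. (if t < s then f t else 0)) = integral X (\<lambda>t. if t \<in> {..<s} then f t else 0)"
    using lebesgue_integral_eq_integral[OF integrable_cut[OF assms(1), of s]] by simp
  also have "\<dots> = integral ({..<s} \<inter> X) f" by (rule integral_restrict_Int)
  also have "{..<s} \<inter> X = {x0<..<s}" using assms by auto
  finally show ?thesis by (simp add: integral_open_interval_real)
qed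

lemma prim_x1: "integrable M f \<Longrightarrow> prim f x1 = (LINT t|M. f t)"
  by (subst prim_eq_lebesgue) (auto intro: Bochner_Integration.integral_cong)

lemma prim_continuous: "integrable M f \<Longrightarrow> continuous_on {x0..x1} (prim f)"
  by (intro indefinite_integral_continuous_1 integrable_on_X)

lemma prim_diff:
  "integrable M f \<Longrightarrow> integrable M g \<Longrightarrow> s \<le> x1 \<Longrightarrow> prim (\<lambda>x. f x - g x) s = prim f s - prim g s"
  by (intro Henstock_Kurzweil_Integration.integral_diff integrable_on_sub) auto

lemma continuous_bounded:
  fixes h :: "real \<Rightarrow> 'b::real_normed_vector"
  assumes h: "continuous_on {x0..x1} h"
  obtains B where "\<And>x. x \<in> {x0..x1} \<Longrightarrow> norm (h x) \<le> B"
  using compact_imp_bounded[OF compact_continuous_image[OF h compact_Icc]]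
  unfolding bounded_iff by blast

lemma continuous_integrable:
  fixes h :: "real \<Rightarrow> 'b::euclidean_space"
  assumes h: "continuous_on {x0..x1} h"
  shows "integrable M h"
proof -
  obtain B where "\<And>x. x \<in> {x0..x1} \<Longrightarrow> norm (h x) \<le> B" using continuous_bounded[OF h] by blast
  then show ?thesis
    by (intro bounded_integrable[OF measurable_continuous_M[OF h], of B] AE_I2) auto
qed

text \<open>\<open>f\<close> is dominated only almost everywhere, hence the detour through the
  Lebesgue integral.\<close>

lemma norm_prim_le:
  assumes f: "integrable M f" and h: "continuous_on {x0..x1} h" and le: "AE x in M. cmod (f x) \<le> h x"
    and s: "s \<le> x1"
  shows "cmod (prim f s) \<le> integral {x0..s} h"
proof -
  note ih = continuous_integrable[OF h]
  have "cmod (prim f s) \<le> (LINT t|M. norm (if t < s then f t else 0))"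
    unfolding prim_eq_lebesgue[OF f s] by simp
  also have "\<dots> \<le> (LINT t|M. (if t < s then h t else 0))"
  proof (rule integral_mono_AE)
    show "AE x in M. cmod (if x < s then f x else 0) \<le> (if x < s then h x else 0)"
      using le by eventually_elim simp
  qed (use integrable_cut[OF f] integrable_cut[OF ih] in auto)
  also have "\<dots> = integral {x0..s} h" using prim_eq_lebesgue[OF ih s] by simp
  finally show ?thesis .
qed

text \<open>Both sides integrate \<open>f t * k s\<close> over the triangle \<open>t < s\<close>.
  The instance \<open>k = \<phi>'\<close> gives integration by parts; the indicator of
  \<open>s < a\<close> gives the test against a ramp.\<close>

lemma Fubini_prim:
  assumes f: "integrable M f" and k [measurable]: "k \<in> borel_measurable M"
    and B: "\<And>x. x \<in> X \<Longrightarrow> cmod (k x) \<le> B"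
  shows "(LINT t|M. f t * (LINT s|M. (if t < s then k s else 0))) = (LINT s|M. prim f s * k s)"
proof -
  note [measurable] = borel_measurable_integrable[OF f]
  define K where "K = (\<lambda>s t. if t < s then f t * k s else (0::complex))"
  have meas [measurable]: "case_prod K \<in> borel_measurable (M \<Otimes>\<^sub>M M)" unfolding K_def by measurable
  have le: "cmod (K s t) \<le> B * cmod (f t)" if "s \<in> X" for s t
  proof -
    have "0 \<le> B" using B[OF that] norm_ge_zero order_trans by blast
    then show ?thesis
      using mult_right_mono[OF B[OF that], of "cmod (f t)"] by (simp add: K_def norm_mult mult.commute)
  qed
  have intK: "integrable M (K s)" if "s \<in> X" for s
  proof (rule Bochner_Integration.integrable_bound)
    show "integrable M (\<lambda>t. B * cmod (f t))" using f by simp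
    show "K s \<in> borel_measurable M" unfolding K_def by measurable
    show "AE t in M. norm (K s t) \<le> norm (B * cmod (f t))"
      using le[OF that] by (intro AE_I2) (smt (verit) real_norm_def)
  qed
  have int: "integrable (M \<Otimes>\<^sub>M M) (case_prod K)"
  proof (rule pair.Fubini_integrable[OF meas])
    show "integrable M (\<lambda>s. LINT t|M. norm (case (s, t) of (s, t) \<Rightarrow> K s t))"
    proof (rule bounded_integrable[of _ "B * (LINT t|M. cmod (f t))"])
      show "AE s in M. norm (LINT t|M. norm (case (s, t) of (s, t) \<Rightarrow> K s t)) \<le> B * (LINT t|M. cmod (f t))"
      proof (rule AE_I2)
        fix s assume s: "s \<in> space M"
        have "norm (LINT t|M. cmod (K s t)) = (LINT t|M. cmod (K s t))" by simp
        also have "\<dots> \<le> (LINT t|M. B * cmod (f t))"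
          using s f intK le by (intro integral_mono) auto
        finally show "norm (LINT t|M. norm (case (s, t) of (s, t) \<Rightarrow> K s t)) \<le> B * (LINT t|M. cmod (f t))"
          by simp
      qed
    qed measurable
    show "AE s in M. integrable M (\<lambda>t. case (s, t) of (s, t) \<Rightarrow> K s t)"
      using intK by auto
  qed
  have "(LINT t|M. f t * (LINT s|M. (if t < s then k s else 0))) = (LINT t|M. LINT s|M. K s t)"
    by (simp add: K_def if_distrib[of "\<lambda>x. f _ * x"] cong: if_cong flip: integral_mult_right_zero)
  also have "\<dots> = (LINT s|M. LINT t|M. K s t)" by (rule pair.Fubini_integral[OF int])
  also have "\<dots> = (LINT s|M. prim f s * k s)"
  proof (intro Bochner_Integration.integral_cong refl)
    fix s assume "s \<in> space M"
    then have "prim f s * k s = (LINT t|M. (if t < s then f t else 0) * k s)"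
      using f by (subst prim_eq_lebesgue) auto
    also have "\<dots> = (LINT t|M. K s t)" by (intro Bochner_Integration.integral_cong) (auto simp: K_def)
    finally show "(LINT t|M. K s t) = prim f s * k s" ..
  qed
  finally show ?thesis .
qed

text \<open>For merely integrable \<open>f\<close> the product rule is replaced by writing
  \<open>\<phi> x1 - \<phi> t\<close> as the integral of \<open>\<phi>'\<close> over
  \<open>{t..x1}\<close> and exchanging the integrations.\<close>

lemma prim_by_parts:
  assumes f: "integrable M f"
    and \<phi>: "\<And>x. (\<phi> has_vector_derivative \<phi>' x) (at x)" "continuous_on UNIV \<phi>'"
  shows "(LINT t|M. f t * \<phi> t) = prim f x1 * \<phi> x1 - (LINT s|M. prim f s * \<phi>' s)"
proof -
  have c\<phi>': "continuous_on {x0..x1} \<phi>'" using \<phi>(2) continuous_on_subset by blast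
  have c\<phi>: "continuous_on {x0..x1} \<phi>"
    using \<phi>(1) by (intro continuous_on_vector_derivative) (auto intro: has_vector_derivative_at_within)
  obtain B where B: "\<And>x. x \<in> {x0..x1} \<Longrightarrow> norm (\<phi>' x) \<le> B" using continuous_bounded[OF c\<phi>'] by blast
  obtain C where C: "\<And>x. x \<in> {x0..x1} \<Longrightarrow> norm (\<phi> x) \<le> C" using continuous_bounded[OF c\<phi>] by blast
  have inner: "(LINT s|M. (if t < s then \<phi>' s else 0)) = \<phi> x1 - \<phi> t" if t: "t \<in> X" for t
  proof -
    have i: "integrable M \<phi>'" by (rule continuous_integrable[OF c\<phi>'])
    note [measurable] = borel_measurable_integrable[OF i]
    have "(LINT s|M. (if t < s then \<phi>' s else 0)) = integral X (\<lambda>s. if s \<in> {t<..} then \<phi>' s else 0)"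
    proof (subst lebesgue_integral_eq_integral)
      show "integrable M (\<lambda>s. if t < s then \<phi>' s else 0)"
      proof (rule Bochner_Integration.integrable_bound[OF i])
        show "(\<lambda>s. if t < s then \<phi>' s else 0) \<in> borel_measurable M"
          by (intro measurable_If borel_measurable_less) auto
      qed auto
    qed auto
    also have "\<dots> = integral ({t<..} \<inter> X) \<phi>'" by (rule integral_restrict_Int)
    also have "{t<..} \<inter> X = {t<..<x1}" using t by auto
    also have "integral {t<..<x1} \<phi>' = integral {t..x1} \<phi>'"
      by (simp add: integral_open_interval_real)
    also have "\<dots> = \<phi> x1 - \<phi> t"
      using t by (intro integral_unique fundamental_theorem_of_calculus has_vector_derivative_at_within[OF \<phi>(1)]) auto
    finally show ?thesis .
  qed
  have i1: "integrable M (\<lambda>t. f t * \<phi> t)"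
  proof (rule Bochner_Integration.integrable_bound)
    show "integrable M (\<lambda>t. C * cmod (f t))" using f by simp
    show "(\<lambda>t. f t * \<phi> t) \<in> borel_measurable M"
      using f measurable_continuous_M[OF c\<phi>] by auto
    have "cmod (f t * \<phi> t) \<le> C * cmod (f t)" if "t \<in> X" for t
      using mult_right_mono[OF C, of t "cmod (f t)"] that by (simp add: norm_mult mult.commute)
    then show "AE t in M. norm (f t * \<phi> t) \<le> norm (C * cmod (f t))"
      by (intro AE_I2) (smt (verit) real_norm_def space_lebesgue_on)
  qed
  have "(LINT s|M. prim f s * \<phi>' s) = (LINT t|M. f t * (LINT s|M. (if t < s then \<phi>' s else 0)))"
    by (rule Fubini_prim[symmetric, where B=B]) (use f B measurable_continuous_M[OF c\<phi>'] in auto)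
  also have "\<dots> = (LINT t|M. f t * \<phi> x1 - f t * \<phi> t)"
    by (intro Bochner_Integration.integral_cong) (auto simp: inner algebra_simps)
  also have "\<dots> = prim f x1 * \<phi> x1 - (LINT t|M. f t * \<phi> t)"
    using f i1 by (simp add: prim_x1)
  finally show ?thesis by simp
qed

text \<open>At almost every point the averages of \<open>k\<close> over \<open>{x..x+h}\<close> tend
  to \<open>k x\<close>, and each average is a difference of two vanishing primitives divided by
  \<open>h\<close>.\<close>

lemma prim_zero_imp_AE_zero:
  assumes k: "integrable M k" and z: "\<And>s. s \<in> X \<Longrightarrow> prim k s = 0"
  shows "AE x in M. k x = 0"
proof -
  \<comment> \<open>Extension by zero, since the differentiation theorem asks for integrability on
    every box of the line.\<close>
  define k0 where "k0 = (\<lambda>x. if x \<in> {x0..x1} then k x else 0)"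
  have k0: "k0 integrable_on cbox a b" for a b
  proof -
    have "k0 integrable_on UNIV" unfolding k0_def
      using integrable_on_X[OF k] by (simp only: integrable_restrict_UNIV)
    then show ?thesis by (rule integrable_on_subcbox) auto
  qed
  obtain N where N: "negligible N"
       "\<And>x e. \<lbrakk>x \<notin> N; 0 < e\<rbrakk> \<Longrightarrow> \<exists>d>0. \<forall>h. 0 < h \<and> h < d \<longrightarrow>
                         norm(integral (cbox x (x + h *\<^sub>R One)) k0 /\<^sub>R h ^ DIM(real) - k0 x) < e"
    using integrable_ccontinuous_explicit[of k0] k0 by blast
  have "k x = 0" if x: "x \<in> X" "x \<notin> N" for x
  proof (rule ccontr)
    assume "k x \<noteq> 0"
    then have "norm (k x) > 0" by simp
    from N(2)[OF x(2) this] obtain d where d: "d > 0"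
      "\<And>h. 0 < h \<Longrightarrow> h < d \<Longrightarrow> norm(integral {x..x + h} k0 /\<^sub>R h - k0 x) < norm (k x)" by auto
    define h where "h = min (d/2) ((x1 - x)/2)"
    have h: "0 < h" "h < d" "x + h < x1" using d(1) x(1) by (auto simp: h_def min_def field_simps)
    have "integral {x..x+h} k0 = integral {x..x+h} k"
      by (rule integral_cong) (use x h in \<open>auto simp: k0_def\<close>)
    moreover have "prim k x + integral {x..x+h} k = prim k (x+h)"
      by (rule Henstock_Kurzweil_Integration.integral_combine) (use x h k in \<open>auto intro: integrable_on_sub\<close>)
    ultimately have "integral {x..x+h} k0 = 0" using z[of x] z[of "x+h"] x h by simp
    with d(2)[OF h(1,2)] x show False by (simp add: k0_def)
  qed
  moreover have "AE x in lebesgue. x \<notin> N"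
    using N(1) by (simp add: AE_not_in negligible_iff_null_sets)
  ultimately show ?thesis unfolding AE_M_iff by (auto elim!: eventually_mono)
qed

text \<open>Makes an admissible test function out of a continuous \<open>k\<close> of mean zero,
  with \<open>k\<close> as its derivative. To the left of \<open>x0\<close> the interval of
  integration is empty, so the primitive is defined and zero there too.\<close>

lemma prim_compact_support:
  assumes k: "continuous_on UNIV k" "\<And>x. x \<notin> {p..q} \<Longrightarrow> k x = (0::complex)"
    and pq: "x0 < p" "q < x1" and int: "(LINT x|M. k x) = 0"
  shows "(prim k has_vector_derivative k x) (at x)" "x \<notin> {p..q} \<Longrightarrow> prim k x = 0"
proof -
  have zero: "prim k x = 0" if "x < p" for x
  proof -
    have "prim k x = integral {x0..x} (\<lambda>x. 0)" using that k(2) by (intro integral_cong) auto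
    then show ?thesis by simp
  qed
  have zero': "prim k x = 0" if "x > q" for x
  proof -
    have eq: "k = (\<lambda>x. if x \<in> {p..q} then k x else 0)" using k(2) by auto
    have "prim k x = integral ({p..q} \<inter> {x0..x}) k" by (subst eq) (rule integral_restrict_Int)
    also have "{p..q} \<inter> {x0..x} = {p..q} \<inter> X" using that pq by auto
    also have "integral ({p..q} \<inter> X) k = integral X k" by (subst (2) eq) (rule integral_restrict_Int[symmetric])
    also have "\<dots> = (LINT x|M. k x)"
      using continuous_integrable[of k] k(1) continuous_on_subset
      by (intro lebesgue_integral_eq_integral[symmetric]) auto
    finally show ?thesis using int by simp
  qed
  show "x \<notin> {p..q} \<Longrightarrow> prim k x = 0" using zero zero' by (cases "x < p") auto
  show "(prim k has_vector_derivative k x) (at x)"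
  proof (cases "x < p")
    case True
    have "((\<lambda>x. 0) has_vector_derivative k x) (at x)" using k(2)[of x] True by simp
    then show ?thesis
      by (rule has_vector_derivative_transform_within_open[of _ _ _ "{..<p}"]) (use True zero in auto)
  next
    case False
    \<comment> \<open>As \<open>x0 < p \<le> x\<close>, the point is interior to
      \<open>{x0..x+1}\<close> and the derivative within the interval is a full one.\<close>
    have "(prim k has_vector_derivative k x) (at x within {x0..x+1})"
      using False pq k(1) by (intro integral_has_vector_derivative) (auto elim: continuous_on_subset)
    then have "(prim k has_vector_derivative k x) (at x within {x0<..<x+1})"
      by (rule has_vector_derivative_within_subset) auto
    then show ?thesis using False pq by (subst (asm) at_within_open) auto
  qed
qed

text \<open>A continuous approximation of the indicator of \<open>{x0<..<a}\<close>: zero up to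
  distance \<open>1 / j\<close> from the endpoints and one from distance \<open>2 / j\<close> on.
  Continuity suffices because cutoffs serve as derivatives of test functions.\<close>

definition cutoff :: "nat \<Rightarrow> real \<Rightarrow> real \<Rightarrow> real" where
  "cutoff j a x = max 0 (min 1 (real j * min (x - x0) (a - x) - 1))"

lemma cutoff_continuous: "continuous_on S (cutoff j a)"
  unfolding cutoff_def by (intro continuous_intros)

lemma cutoff_support: "j > 0 \<Longrightarrow> x \<notin> {x0 + 1 / real j .. a - 1 / real j} \<Longrightarrow> cutoff j a x = 0"
proof -
  assume j: "j > 0" and "x \<notin> {x0 + 1 / real j .. a - 1 / real j}"
  then have "min (x - x0) (a - x) \<le> 1 / real j" by auto
  then have "real j * min (x - x0) (a - x) \<le> real j * (1 / real j)" by (intro mult_left_mono) auto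
  also have "\<dots> = 1" using j by simp
  finally show "cutoff j a x = 0" by (simp add: cutoff_def)
qed

lemma cutoff_bounds: "0 \<le> cutoff j a x" "cutoff j a x \<le> 1"
  by (auto simp: cutoff_def)

lemma cutoff_tendsto:
  assumes "x0 < x"
  shows "(\<lambda>j. cutoff j a x) \<longlonglongrightarrow> (if x < a then 1 else 0)"
proof (cases "x < a")
  case True
  define m where "m = min (x - x0) (a - x)"
  have m: "m > 0" using True assms by (auto simp: m_def)
  have "\<forall>\<^sub>F j in sequentially. real j \<ge> 2 / m"
    using filterlim_real_sequentially by (auto simp: filterlim_at_top)
  then have "\<forall>\<^sub>F j in sequentially. cutoff j a x = 1"
    by eventually_elim (use m in \<open>auto simp: cutoff_def field_simps simp flip: m_def\<close>)
  then show ?thesis using True by (simp add: tendsto_eventually)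
next
  case False
  then have "real j * min (x - x0) (a - x) \<le> 0" for j by (auto simp: min_def mult_nonneg_nonpos)
  then have "cutoff j a x = 0" for j by (smt (verit) cutoff_def)
  then show ?thesis using False by simp
qed

lemma integral_cutoff_tendsto:
  assumes f: "integrable M f" and a: "a \<le> x1"
  shows "(\<lambda>j. LINT x|M. f x * complex_of_real (cutoff j a x)) \<longlonglongrightarrow> prim f a"
  unfolding prim_eq_lebesgue[OF assms]
proof (rule integral_dominated_convergence[where w="\<lambda>x. cmod (f x)"])
  note [measurable] = borel_measurable_integrable[OF f]
  show "(\<lambda>t. if t < a then f t else 0) \<in> borel_measurable M" by measurable
  show "(\<lambda>x. f x * complex_of_real (cutoff j a x)) \<in> borel_measurable M" for j
    unfolding cutoff_def by measurable
  show "integrable M (\<lambda>x. cmod (f x))" using f by simp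
  show "AE x in M. (\<lambda>j. f x * complex_of_real (cutoff j a x)) \<longlonglongrightarrow> (if x < a then f x else 0)"
  proof (rule AE_I2)
    fix x assume "x \<in> space M"
    then have "(\<lambda>j. f x * complex_of_real (cutoff j a x)) \<longlonglongrightarrow> f x * complex_of_real (if x < a then 1 else 0)"
      by (intro tendsto_intros cutoff_tendsto) auto
    then show "(\<lambda>j. f x * complex_of_real (cutoff j a x)) \<longlonglongrightarrow> (if x < a then f x else 0)"
      by (auto split: if_splits)
  qed
  show "AE x in M. norm (f x * complex_of_real (cutoff j a x)) \<le> cmod (f x)" for j
    using cutoff_bounds[of j a] by (intro AE_I2) (simp add: norm_mult mult_left_le)
qed

text \<open>The hypothesis makes \<open>h\<close> orthogonal to continuous functions of mean zero
  with compact support in \<open>X\<close>. Applied to a combination of two cutoffs it shows, in the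
  limit, that the primitive of \<open>h\<close> is linear; subtracting the mean of \<open>h\<close>
  then leaves a function with vanishing primitive.\<close>

lemma du_Bois_Reymond:
  assumes h: "integrable M h"
    and z: "\<And>\<phi> \<phi>' :: real \<Rightarrow> complex. (\<forall>x. (\<phi> has_vector_derivative \<phi>' x) (at x)) \<Longrightarrow>
        continuous_on UNIV \<phi>' \<Longrightarrow> (\<exists>K. compact K \<and> K \<subseteq> X \<and> (\<forall>x. x \<notin> K \<longrightarrow> \<phi> x = 0)) \<Longrightarrow>
        (LINT x|M. h x * \<phi>' x) = 0"
  shows "\<exists>c. AE x in M. h x = c"
proof -
  let ?\<chi> = "\<lambda>j a x. complex_of_real (cutoff j a x)"
  define I where "I = (\<lambda>f j a. LINT x|M. f x * ?\<chi> j a x)"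
  have icut: "integrable M (\<lambda>x. f x * ?\<chi> j a x)" if "integrable M f" for f j a
  proof (rule Bochner_Integration.integrable_bound[OF that])
    show "(\<lambda>x. f x * ?\<chi> j a x) \<in> borel_measurable M"
      using borel_measurable_integrable[OF that] unfolding cutoff_def by measurable
    show "AE x in M. norm (f x * ?\<chi> j a x) \<le> norm (f x)"
      using cutoff_bounds[of j a] by (intro AE_I2) (simp add: norm_mult mult_left_le)
  qed
  have one: "integrable M (\<lambda>x. 1 :: complex)" by simp
  have eq: "I (\<lambda>x. 1) j x1 * I h j a = I (\<lambda>x. 1) j a * I h j x1" if j: "j > 0" and a: "a \<le> x1" for j a
  proof -
    \<comment> \<open>Each cutoff is weighted with the integral of the other, so the mean of
      \<open>k\<close> cancels without a division.\<close>
    define k where "k = (\<lambda>x. I (\<lambda>x. 1) j x1 * ?\<chi> j a x - I (\<lambda>x. 1) j a * ?\<chi> j x1 x)"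
    have k: "continuous_on UNIV k" unfolding k_def
      by (intro continuous_intros cutoff_continuous)
    define p where "p = x0 + 1 / real j"
    define q where "q = x1 - 1 / real j"
    have supp: "k x = 0" if "x \<notin> {p..q}" for x
    proof -
      have "x \<notin> {x0 + 1 / real j .. a - 1 / real j}" using that a by (auto simp: p_def q_def)
      then show ?thesis using that j unfolding p_def q_def by (simp add: k_def cutoff_support)
    qed
    have pq: "x0 < p" "q < x1" using j by (auto simp: p_def q_def)
    have int: "(LINT x|M. k x) = 0"
      using icut[OF one, of j a] icut[OF one, of j x1] by (simp add: k_def I_def)
    note pcs = prim_compact_support[OF k supp pq int]
    have "(LINT x|M. h x * k x) = 0"
    proof (rule z[of "prim k"])
      show "\<exists>K. compact K \<and> K \<subseteq> X \<and> (\<forall>x. x \<notin> K \<longrightarrow> prim k x = 0)"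
        using pcs(2) pq by (intro exI[of _ "{p..q}"]) auto
    qed (use k pcs in auto)
    moreover have "(LINT x|M. h x * k x) = (LINT x|M. I (\<lambda>x. 1) j x1 * (h x * ?\<chi> j a x) - I (\<lambda>x. 1) j a * (h x * ?\<chi> j x1 x))"
      by (simp add: k_def algebra_simps)
    moreover have "\<dots> = I (\<lambda>x. 1) j x1 * I h j a - I (\<lambda>x. 1) j a * I h j x1"
      using icut[OF h] by (simp add: I_def)
    ultimately show ?thesis by simp
  qed
  \<comment> \<open>As the cutoffs tend to the indicators of $(x_0,a)$ and $(x_0,x_1)$, the primitive of $h$ becomes linear.\<close>
  have lim: "of_real (x1 - x0) * prim h a = of_real (a - x0) * prim h x1" if a: "a \<in> X" for a
  proof -
    have A: "(\<lambda>j. I (\<lambda>x. 1) j x1 * I h j a) \<longlonglongrightarrow> prim (\<lambda>x. 1) x1 * prim h a"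
      unfolding I_def using a by (intro tendsto_mult integral_cutoff_tendsto one h) auto
    have B: "(\<lambda>j. I (\<lambda>x. 1) j a * I h j x1) \<longlonglongrightarrow> prim (\<lambda>x. 1) a * prim h x1"
      unfolding I_def using a by (intro tendsto_mult integral_cutoff_tendsto one h) auto
    have E: "\<forall>\<^sub>F j in sequentially. I (\<lambda>x. 1) j x1 * I h j a = I (\<lambda>x. 1) j a * I h j x1"
      using eventually_gt_at_top[of 0] by eventually_elim (use eq a in auto)
    have "prim (\<lambda>x. 1) x1 * prim h a = prim (\<lambda>x. 1) a * prim h x1"
      by (rule LIMSEQ_unique[OF A iffD2[OF tendsto_cong[OF E] B]])
    then show ?thesis using a x0_less_x1 by (simp add: scaleR_conv_of_real)
  qed
  define c where "c = prim h x1 / of_real (x1 - x0)"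
  have "AE x in M. h x - c = 0"
  proof (rule prim_zero_imp_AE_zero)
    show "integrable M (\<lambda>x. h x - c)" using h by simp
    fix s assume s: "s \<in> X"
    have "prim (\<lambda>x. h x - c) s = prim h s - of_real (s - x0) * c"
      using prim_diff[OF h, of "\<lambda>_. c" s] s by (simp add: scaleR_conv_of_real)
    also have "\<dots> = 0" using lim[OF s] x0_less_x1 by (simp add: c_def field_simps)
    finally show "prim (\<lambda>x. h x - c) s = 0" .
  qed
  then show ?thesis by auto
qed

section \<open>Sobolev functions as primitives\<close>

text \<open>\<open>c + prim g\<close> is the absolutely continuous representative of
  \<open>u\<close>, with value \<open>c\<close> at \<open>x0\<close> and weak derivative
  \<open>g\<close>. Carrying \<open>c\<close> and \<open>g\<close> explicitly avoids the choice
  inside \<open>wderiv\<close> and gives endpoint values a meaning.\<close>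

definition has_prim :: "(real \<Rightarrow> complex) \<Rightarrow> complex \<Rightarrow> (real \<Rightarrow> complex) \<Rightarrow> bool" where
  "has_prim u c g \<longleftrightarrow> u \<in> borel_measurable M \<and> g \<in> L2 X \<and> (AE x in M. u x = c + prim g x)"

lemma continuous_L2: "continuous_on {x0..x1} f \<Longrightarrow> f \<in> L2 X"
proof -
  assume f: "continuous_on {x0..x1} f"
  obtain B where "\<And>x. x \<in> {x0..x1} \<Longrightarrow> norm (f x) \<le> B" using continuous_bounded[OF f] by blast
  then show ?thesis by (intro bounded_L2[of _ B] measurable_continuous_M f AE_I2) auto
qed

lemma affine_prim_continuous: "integrable M g \<Longrightarrow> continuous_on {x0..x1} (\<lambda>x. c + prim g x)"
  by (intro continuous_on_add continuous_on_const prim_continuous)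

lemma test_function_facts:
  assumes "\<forall>x. (\<phi> has_vector_derivative \<phi>' x) (at x)" "continuous_on UNIV (\<phi>' :: real \<Rightarrow> complex)"
     "\<exists>K. compact K \<and> K \<subseteq> X \<and> (\<forall>x. x \<notin> K \<longrightarrow> \<phi> x = 0)"
  shows "\<phi> x0 = 0" "\<phi> x1 = 0" "\<phi>' \<in> L2 X" "\<phi> \<in> L2 X" "(LINT x|M. \<phi>' x) = 0"
proof -
  show 0: "\<phi> x0 = 0" "\<phi> x1 = 0" using assms(3) by (metis greaterThanLessThan_iff less_irrefl subsetD)+
  have c: "continuous_on {x0..x1} \<phi>'" using assms(2) continuous_on_subset by blast
  have c\<phi>: "continuous_on {x0..x1} \<phi>"
    using assms(1) by (intro continuous_on_vector_derivative) (auto intro: has_vector_derivative_at_within)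
  show "\<phi>' \<in> L2 X" "\<phi> \<in> L2 X" using continuous_L2 c c\<phi> by auto
  have "(\<phi>' has_integral \<phi> x1 - \<phi> x0) {x0..x1}"
    using assms(1) x0_less_x1 by (intro fundamental_theorem_of_calculus) (auto intro: has_vector_derivative_at_within)
  then have "prim \<phi>' x1 = 0" using 0 by (simp add: integral_unique)
  then show "(LINT x|M. \<phi>' x) = 0" using prim_x1[OF continuous_integrable[OF c]] by simp
qed

lemma has_prim_L2:
  assumes "has_prim u c g" shows "u \<in> L2 X"
proof (rule L2_AE_cong)
  show "(\<lambda>x. c + prim g x) \<in> L2 X"
    using assms by (intro continuous_L2[OF affine_prim_continuous[OF L2_integrable]]) (auto simp: has_prim_def)
qed (use assms in \<open>auto simp: has_prim_def elim: eventually_mono\<close>)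

text \<open>Integration by parts with vanishing boundary terms; the constant \<open>c\<close> drops
  out because \<open>\<phi>'\<close> has integral zero.\<close>

lemma has_prim_imp_weak_deriv:
  assumes u: "has_prim u c g" shows "weak_deriv X u g"
  unfolding weak_deriv_def
proof safe
  fix \<phi> \<phi>' :: "real \<Rightarrow> complex" and K
  assume t: "\<forall>x. (\<phi> has_vector_derivative \<phi>' x) (at x)" "continuous_on UNIV \<phi>'"
    "compact K" "K \<subseteq> X" "\<forall>x. x \<notin> K \<longrightarrow> \<phi> x = 0"
  have "\<exists>K. compact K \<and> K \<subseteq> X \<and> (\<forall>x. x \<notin> K \<longrightarrow> \<phi> x = 0)" using t(3-5) by blast
  note tf = test_function_facts[OF t(1,2) this]
  have g: "integrable M g" using u by (auto simp: has_prim_def L2_integrable)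
  have p: "prim g \<in> L2 X" by (intro continuous_L2 prim_continuous g)
  have "(LINT x|M. u x * \<phi>' x) = (LINT x|M. c * \<phi>' x + prim g x * \<phi>' x)"
  proof (rule integral_cong_AE)
    show "AE x in M. u x * \<phi>' x = c * \<phi>' x + prim g x * \<phi>' x"
      using u unfolding has_prim_def by (auto elim!: eventually_mono simp: algebra_simps)
  qed (use L2_measurable[OF tf(3)] L2_measurable[OF p] u in \<open>auto simp: has_prim_def\<close>)
  also have "\<dots> = (LINT x|M. prim g x * \<phi>' x)"
    using L2_integrable[OF tf(3)] L2_mult[OF p tf(3)] tf(5) by simp
  also have "\<dots> = - (LINT x|M. g x * \<phi> x)"
    using prim_by_parts[OF g, of \<phi> \<phi>'] t(1,2) tf(2) by simp
  finally show "(LINT x|M. u x * \<phi>' x) = - (LINT x|M. g x * \<phi> x)" .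
qed

text \<open>\<open>u\<close> and \<open>prim g\<close> have the same weak derivative, so their
  difference is orthogonal to every \<open>\<phi>'\<close> and hence constant.\<close>

lemma weak_deriv_imp_has_prim:
  assumes u: "u \<in> L2 X" and g: "g \<in> L2 X" and w: "weak_deriv X u g"
  shows "\<exists>c. has_prim u c g"
proof -
  note ig = L2_integrable[OF g]
  have p: "prim g \<in> L2 X" by (intro continuous_L2 prim_continuous ig)
  have "\<exists>c. AE x in M. u x - prim g x = c"
  proof (rule du_Bois_Reymond)
    show "integrable M (\<lambda>x. u x - prim g x)" using L2_integrable[OF u] L2_integrable[OF p] by simp
    fix \<phi> \<phi>' :: "real \<Rightarrow> complex"
    assume t: "\<forall>x. (\<phi> has_vector_derivative \<phi>' x) (at x)" "continuous_on UNIV \<phi>'"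
      "\<exists>K. compact K \<and> K \<subseteq> X \<and> (\<forall>x. x \<notin> K \<longrightarrow> \<phi> x = 0)"
    note tf = test_function_facts[OF t]
    have "(LINT x|M. (u x - prim g x) * \<phi>' x) = (LINT x|M. u x * \<phi>' x) - (LINT x|M. prim g x * \<phi>' x)"
      using L2_mult[OF u tf(3)] L2_mult[OF p tf(3)] by (simp add: left_diff_distrib)
    also have "(LINT x|M. u x * \<phi>' x) = - (LINT x|M. g x * \<phi> x)"
      using w t unfolding weak_deriv_def by blast
    also have "(LINT x|M. prim g x * \<phi>' x) = - (LINT x|M. g x * \<phi> x)"
      using prim_by_parts[OF ig, of \<phi> \<phi>'] t(1,2) tf(2) by simp
    finally show "(LINT x|M. (u x - prim g x) * \<phi>' x) = 0" by simp
  qed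
  then obtain c where "AE x in M. u x - prim g x = c" by blast
  then have "AE x in M. u x = c + prim g x" by (auto elim!: eventually_mono simp: algebra_simps)
  then show ?thesis using g L2_measurable[OF u] by (auto simp: has_prim_def)
qed

lemma AE_interval_ex:
  fixes a b :: real
  assumes "a < b" "AE x in lebesgue. a < x \<and> x < b \<longrightarrow> P x"
  shows "\<exists>x. a < x \<and> x < b \<and> P x"
proof (rule ccontr)
  assume "\<not> ?thesis"
  with assms(2) have "AE x in lebesgue. x \<notin> {a<..<b}" by (auto elim: eventually_mono)
  moreover have "{a<..<b} \<in> sets lebesgue" by (intro sets_completionI_sets) simp
  ultimately have "{a<..<b} \<in> null_sets lebesgue" using AE_iff_null_sets by blast
  then show False using assms(1) by (auto simp: null_sets_def)
qed

lemma AE_eq_continuous_imp_eq: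
  fixes f g :: "real \<Rightarrow> complex"
  assumes f: "continuous_on {x0..x1} f" and g: "continuous_on {x0..x1} g"
    and ae: "AE x in M. f x = g x" and x: "x \<in> {x0..x1}"
  shows "f x = g x"
proof (rule ccontr)
  assume "f x \<noteq> g x"
  have "continuous_on {x0..x1} (\<lambda>x. dist (f x) (g x))" by (intro continuous_intros f g)
  then obtain d where d: "d > 0" "\<And>y. y \<in> {x0..x1} \<Longrightarrow> dist y x < d \<Longrightarrow> dist (dist (f y) (g y)) (dist (f x) (g x)) < dist (f x) (g x)"
    using x \<open>f x \<noteq> g x\<close> unfolding continuous_on_iff by (metis zero_less_dist_iff)
  define a where "a = max x0 (x - d)"
  define b where "b = min x1 (x + d)"
  have ab: "a < b" using x d(1) x0_less_x1 by (auto simp: a_def b_def)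
  have "AE y in lebesgue. a < y \<and> y < b \<longrightarrow> f y = g y"
    using ae unfolding AE_M_iff by (auto elim!: eventually_mono simp: a_def b_def)
  from AE_interval_ex[OF ab this] obtain y where y: "a < y" "y < b" "f y = g y" by blast
  then have "y \<in> {x0..x1}" "dist y x < d" by (auto simp: a_def b_def dist_real_def)
  from d(2)[OF this] y(3) show False by (simp add: dist_real_def)
qed

text \<open>The continuous representatives agree almost everywhere, hence everywhere. Evaluation at
  \<open>x0\<close> isolates the constants, and the remaining primitives determine the
  derivatives.\<close>

lemma has_prim_unique:
  assumes "has_prim u c g" "has_prim u c' g'"
  shows "c = c'" "AE x in M. g x = g' x"
proof -
  have i: "integrable M g" "integrable M g'" using assms by (auto simp: has_prim_def L2_integrable)
  have *: "c + prim g x = c' + prim g' x" if "x \<in> {x0..x1}" for x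
  proof (rule AE_eq_continuous_imp_eq)
    show "AE x in M. c + prim g x = c' + prim g' x"
      using assms unfolding has_prim_def by (auto elim: eventually_elim2)
  qed (use that i in \<open>auto intro: affine_prim_continuous\<close>)
  from *[of x0] show "c = c'" using x0_less_x1 by simp
  have "AE x in M. g x - g' x = 0"
    by (rule prim_zero_imp_AE_zero) (use i * \<open>c = c'\<close> prim_diff in auto)
  then show "AE x in M. g x = g' x" by simp
qed

lemma W12_has_prim: "u \<in> W12 X \<Longrightarrow> \<exists>c. has_prim u c (wderiv X u)"
proof -
  assume u: "u \<in> W12 X"
  then have "\<exists>g. g \<in> L2 X \<and> weak_deriv X u g" by (auto simp: W12_def)
  from someI_ex[OF this] have "wderiv X u \<in> L2 X \<and> weak_deriv X u (wderiv X u)"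
    unfolding wderiv_def .
  with u show ?thesis by (intro weak_deriv_imp_has_prim) (auto simp: W12_def)
qed

lemma has_prim_W12:
  assumes "has_prim u c g" shows "u \<in> W12 X"
  using has_prim_imp_weak_deriv[OF assms] has_prim_L2[OF assms] assms by (auto simp: W12_def has_prim_def)

text \<open>Allows any known derivative to stand in for the one chosen by \<open>SOME\<close>. This
  matters for differences, where \<open>wderiv\<close> makes a fresh choice that need not be
  literally the difference of the two earlier ones.\<close>

lemma has_prim_wderiv:
  assumes "has_prim u c g" shows "has_prim u c (wderiv X u)" "AE x in M. wderiv X u x = g x"
proof -
  obtain c' where c': "has_prim u c' (wderiv X u)" using W12_has_prim[OF has_prim_W12[OF assms]] by blast
  from has_prim_unique[OF this assms] c'
  show "has_prim u c (wderiv X u)" "AE x in M. wderiv X u x = g x" by auto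
qed

lemma has_prim_diff:
  assumes "has_prim u c g" "has_prim v d h"
  shows "has_prim (\<lambda>x. u x - v x) (c - d) (\<lambda>x. g x - h x)"
  unfolding has_prim_def
proof (intro conjI)
  have i: "integrable M g" "integrable M h" using assms by (auto simp: has_prim_def L2_integrable)
  have "AE x in M. u x = c + prim g x" "AE x in M. v x = d + prim h x" using assms by (auto simp: has_prim_def)
  then show "AE x in M. u x - v x = c - d + prim (\<lambda>x. g x - h x) x"
    using AE_space by eventually_elim (use i prim_diff in auto)
qed (use assms in \<open>auto simp: has_prim_def L2_diff\<close>)

end

text \<open>Completeness: the constant may vary with \<open>e\<close>, but any two values of
  \<open>f\<close> that are close to the same constant are close to each other, so the image filter
  is Cauchy.\<close>

lemma tendsto_of_approximations:
  fixes f :: "'a \<Rightarrow> complex"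
  assumes "F \<noteq> bot" "\<And>e. e > 0 \<Longrightarrow> \<exists>c. \<forall>\<^sub>F x in F. cmod (f x - c) < e"
  shows "\<exists>l. (f \<longlongrightarrow> l) F"
proof -
  have "cauchy_filter (filtermap f F)"
    unfolding cauchy_filter_metric_filtermap
  proof (intro allI impI)
    fix e :: real assume "e > 0"
    then obtain c where c: "\<forall>\<^sub>F x in F. cmod (f x - c) < e / 2" using assms(2)[of "e/2"] by auto
    have "dist (f x) (f y) < e" if "cmod (f x - c) < e / 2" "cmod (f y - c) < e / 2" for x y
      using dist_triangle_half_l[of "f x" c e "f y"] that by (simp add: dist_norm norm_minus_commute)
    then show "\<exists>P. eventually P F \<and> (\<forall>x y. P x \<and> P y \<longrightarrow> dist (f x) (f y) < e)"
      using c by blast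
  qed
  then have "convergent_filter (filtermap f F)"
    by (simp add: convergent_filter_iff_cauchy)
  then show ?thesis
    unfolding convergent_filter_iff filterlim_def by blast
qed

context bounded_interval begin

section \<open>Essential one-sided limits at the endpoints\<close>

abbreviation left_end :: "real filter" where "left_end \<equiv> ess_at_right x0"
abbreviation right_end :: "real filter" where "right_end \<equiv> ess_at_left x1"

lemma left_end_nontrivial: "left_end \<noteq> bot"
proof
  assume "left_end = bot"
  then have "eventually (\<lambda>x. False) left_end" by simp
  then show False unfolding eventually_ess_at_right using AE_interval_ex[of x0 _ "\<lambda>_. False"] by blast
qed

lemma right_end_nontrivial: "right_end \<noteq> bot"
proof
  assume "right_end = bot"
  then have "eventually (\<lambda>x. False) right_end" by simp
  then show False unfolding eventually_ess_at_left using AE_interval_ex[of _ x1 "\<lambda>_. False"] by blast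
qed

text \<open>The endpoint filter ignores null sets, so identities that hold almost everywhere on
  \<open>X\<close> may be used under these limits.\<close>

lemma AE_imp_left_end: "AE x in M. P x \<Longrightarrow> eventually P left_end"
  unfolding eventually_ess_at_right AE_M_iff using x0_less_x1 by blast

lemma AE_imp_right_end: "AE x in M. P x \<Longrightarrow> eventually P right_end"
  unfolding eventually_ess_at_left AE_M_iff using x0_less_x1 by blast

lemma continuous_left_end:
  assumes "continuous_on {x0..x1} f" shows "(f \<longlongrightarrow> f x0) left_end"
proof -
  have "(f \<longlongrightarrow> f x0) (at_right x0)"
    using assms x0_less_x1 by (simp add: continuous_on_Icc_at_rightD)
  then show ?thesis by (rule tendsto_mono[rotated]) (simp add: ess_at_right_def)
qed

lemma continuous_right_end:
  assumes "continuous_on {x0..x1} f" shows "(f \<longlongrightarrow> f x1) right_end"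
proof -
  have "(f \<longlongrightarrow> f x1) (at_left x1)"
    using assms x0_less_x1 by (simp add: continuous_on_Icc_at_leftD)
  then show ?thesis by (rule tendsto_mono[rotated]) (simp add: ess_at_left_def)
qed

lemma tendsto_left_end:
  assumes "continuous_on {x0..x1} f" "AE x in M. u x = f x" shows "(u \<longlongrightarrow> f x0) left_end"
  using continuous_left_end[OF assms(1)] tendsto_cong[OF AE_imp_left_end[OF assms(2)]] by blast

lemma tendsto_right_end:
  assumes "continuous_on {x0..x1} f" "AE x in M. u x = f x" shows "(u \<longlongrightarrow> f x1) right_end"
  using continuous_right_end[OF assms(1)] tendsto_cong[OF AE_imp_right_end[OF assms(2)]] by blast

lemma has_prim_limits:
  assumes "has_prim u c g"
  shows "(u \<longlongrightarrow> c) left_end" "(u \<longlongrightarrow> c + prim g x1) right_end" "rlim u x0 = c" "llim u x1 = c + prim g x1"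
proof -
  have c: "continuous_on {x0..x1} (\<lambda>x. c + prim g x)"
    using assms by (auto simp: has_prim_def intro: affine_prim_continuous L2_integrable)
  have ae: "AE x in M. u x = c + prim g x" using assms by (simp add: has_prim_def)
  show 1: "(u \<longlongrightarrow> c) left_end" using tendsto_left_end[OF c ae] by simp
  show 2: "(u \<longlongrightarrow> c + prim g x1) right_end" using tendsto_right_end[OF c ae] by simp
  show "rlim u x0 = c" unfolding rlim_def using 1 left_end_nontrivial by (intro tendsto_Lim) auto
  show "llim u x1 = c + prim g x1" unfolding llim_def using 2 right_end_nontrivial by (intro tendsto_Lim) auto
qed

section \<open>Essentially bounded and regulated functions\<close>

lemma norm_Linf_le:
  assumes "f \<in> borel_measurable M" "AE x in M. cmod (f x) \<le> B"
  shows "norm_Linf X f \<le> ereal B"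
  unfolding norm_Linf_def using assms by (intro esssup_I) auto

lemma norm_Linf_less:
  assumes "norm_Linf X f < ereal e" shows "AE x in M. cmod (f x) < e"
  using esssup_AE[where M=M and f="\<lambda>x. ereal (cmod (f x))"]
proof eventually_elim
  case (elim x)
  then show ?case using assms unfolding norm_Linf_def by (metis ereal_less_eq(3) le_less_trans less_ereal.simps(1))
qed

text \<open>Over a null space an essential supremum in \<open>ereal\<close> would be minus infinity;
  the positive measure of \<open>X\<close> excludes this.\<close>

lemma norm_Linf_nonneg: "f \<in> borel_measurable M \<Longrightarrow> 0 \<le> norm_Linf X f"
proof -
  assume [measurable]: "f \<in> borel_measurable M"
  have "emeasure M (space M) \<noteq> 0" using x0_less_x1 by (simp add: emeasure_restrict_space)
  then have "0 = esssup M (\<lambda>x. 0 :: ereal)" by (simp add: esssup_const)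
  also have "\<dots> \<le> norm_Linf X f" unfolding norm_Linf_def by (intro esssup_mono) auto
  finally show ?thesis .
qed

lemma Linf_measurable: "f \<in> Linf X \<Longrightarrow> f \<in> borel_measurable M"
  by (simp add: Linf_def)

lemma Linf_bounded:
  assumes "f \<in> Linf X" obtains B where "AE x in M. cmod (f x) \<le> B"
proof -
  from assms obtain B where "norm_Linf X f < ereal B"
    unfolding Linf_def using less_PInf_Ex_of_nat by auto
  from norm_Linf_less[OF this] show ?thesis by (intro that[of B]) (auto elim: eventually_mono)
qed

lemma LinfI: "f \<in> borel_measurable M \<Longrightarrow> AE x in M. cmod (f x) \<le> B \<Longrightarrow> f \<in> Linf X"
  using norm_Linf_le[of f B] by (auto simp: Linf_def)

lemma tendsto_LinfD:
  assumes "tendsto_Linf X f g" "e > 0"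
  shows "\<forall>\<^sub>F n in sequentially. AE x in M. cmod (f n x - g x) < e"
proof -
  have "\<forall>\<^sub>F n in sequentially. norm_Linf X (\<lambda>x. f n x - g x) < ereal e"
    using assms by (intro order_tendstoD(2)[of _ 0]) (auto simp: tendsto_Linf_def)
  then show ?thesis by eventually_elim (rule norm_Linf_less)
qed

lemma tendsto_LinfI:
  assumes f: "\<And>n. f n \<in> Linf X" and g: "g \<in> Linf X"
    and lim: "\<And>e. e > 0 \<Longrightarrow> \<forall>\<^sub>F n in sequentially. AE x in M. cmod (f n x - g x) \<le> e"
  shows "tendsto_Linf X f g"
  unfolding tendsto_Linf_def
proof (intro conjI allI f g)
  note [measurable] = f[THEN Linf_measurable] g[THEN Linf_measurable]
  show "(\<lambda>n. norm_Linf X (\<lambda>x. f n x - g x)) \<longlonglongrightarrow> 0"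
  proof (rule order_tendstoI)
    fix a :: ereal assume "a < 0"
    then have "a < norm_Linf X (\<lambda>x. f n x - g x)" for n
      by (rule less_le_trans) (rule norm_Linf_nonneg, measurable)
    then show "\<forall>\<^sub>F n in sequentially. a < norm_Linf X (\<lambda>x. f n x - g x)" by simp
  next
    fix a :: ereal assume "0 < a"
    then obtain e where e: "0 < ereal e" "ereal e < a" using ereal_dense2 by blast
    then have "\<forall>\<^sub>F n in sequentially. AE x in M. cmod (f n x - g x) \<le> e" by (intro lim) auto
    then show "\<forall>\<^sub>F n in sequentially. norm_Linf X (\<lambda>x. f n x - g x) < a"
    proof eventually_elim
      case (elim n)
      then have "norm_Linf X (\<lambda>x. f n x - g x) \<le> ereal e" by (intro norm_Linf_le) measurable
      then show ?case using e(2) by (rule le_less_trans)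
    qed
  qed
qed

lemma piecewise_constant_ends:
  assumes "s \<in> piecewise_constant X"
  shows "\<exists>c. \<forall>\<^sub>F x in left_end. s x = c" "\<exists>c. \<forall>\<^sub>F x in right_end. s x = c"
proof -
  obtain F where F: "finite F" "\<And>x y. x \<in> X \<Longrightarrow> y \<in> X \<Longrightarrow> x \<le> y \<Longrightarrow> {x..y} \<inter> F = {} \<Longrightarrow> s x = s y"
    using assms unfolding piecewise_constant_def by blast
  \<comment> \<open>The first point of \<open>F\<close> to the right of \<open>x0\<close>, capped at
    \<open>x1\<close>: between \<open>x0\<close> and \<open>b\<close> the function equals its value
    at the midpoint.\<close>
  define b where "b = Min (insert x1 {y\<in>F. x0 < y})"
  have b: "x0 < b" "b \<le> x1" "\<And>y. y \<in> F \<Longrightarrow> x0 < y \<Longrightarrow> b \<le> y"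
    using F(1) x0_less_x1 by (auto simp: b_def)
  have sc: "s x = s ((x0 + b) / 2)" if "x0 < x" "x < b" for x
  proof (cases "x \<le> (x0+b)/2")
    case True
    then show ?thesis using that b by (intro F(2)) (fastforce)+
  next
    case False
    then show ?thesis using that b by (intro F(2)[symmetric]) (fastforce)+
  qed
  then show "\<exists>c. \<forall>\<^sub>F x in left_end. s x = c"
    unfolding eventually_ess_at_right by (intro exI[of _ "s ((x0 + b) / 2)"] exI[of _ b] conjI b(1) AE_I2) blast
  define a where "a = Max (insert x0 {y\<in>F. y < x1})"
  have a: "a < x1" "x0 \<le> a" "\<And>y. y \<in> F \<Longrightarrow> y < x1 \<Longrightarrow> y \<le> a"
    using F(1) x0_less_x1 by (auto simp: a_def)
  have sc: "s x = s ((a + x1) / 2)" if "a < x" "x < x1" for x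
  proof (cases "x \<le> (a+x1)/2")
    case True
    then show ?thesis using that a by (intro F(2)) (fastforce)+
  next
    case False
    then show ?thesis using that a by (intro F(2)[symmetric]) (fastforce)+
  qed
  then show "\<exists>c. \<forall>\<^sub>F x in right_end. s x = c"
    unfolding eventually_ess_at_left by (intro exI[of _ "s ((a + x1) / 2)"] exI[of _ a] conjI a(1) AE_I2) blast
qed

text \<open>A step function is constant near each endpoint, so \<open>f\<close> is there essentially
  within any \<open>e\<close> of some constant, and completeness yields the limits.\<close>

lemma Reg_limits:
  assumes "f \<in> Reg X"
  shows "(f \<longlongrightarrow> rlim f x0) left_end" "(f \<longlongrightarrow> llim f x1) right_end"
proof -
  have "\<exists>c. \<forall>\<^sub>F x in left_end. cmod (f x - c) < e"
       "\<exists>c. \<forall>\<^sub>F x in right_end. cmod (f x - c) < e" if e: "e > 0" for e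
  proof -
    obtain s where s: "s \<in> piecewise_constant X" "norm_Linf X (\<lambda>x. f x - s x) < ereal e"
      using assms e unfolding Reg_def by blast
    note ae = norm_Linf_less[OF s(2)]
    from piecewise_constant_ends[OF s(1)] obtain c d where c: "\<forall>\<^sub>F x in left_end. s x = c"
      and d: "\<forall>\<^sub>F x in right_end. s x = d" by blast
    from c AE_imp_left_end[OF ae] have "\<forall>\<^sub>F x in left_end. cmod (f x - c) < e" by eventually_elim simp
    moreover from d AE_imp_right_end[OF ae] have "\<forall>\<^sub>F x in right_end. cmod (f x - d) < e" by eventually_elim simp
    ultimately show "\<exists>c. \<forall>\<^sub>F x in left_end. cmod (f x - c) < e"
       "\<exists>c. \<forall>\<^sub>F x in right_end. cmod (f x - c) < e" by blast+
  qed
  then obtain l r where lr: "(f \<longlongrightarrow> l) left_end" "(f \<longlongrightarrow> r) right_end"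
    using tendsto_of_approximations[OF left_end_nontrivial, of f] tendsto_of_approximations[OF right_end_nontrivial, of f] by blast
  have "rlim f x0 = l" "llim f x1 = r"
    unfolding rlim_def llim_def using lr left_end_nontrivial right_end_nontrivial by (auto intro!: tendsto_Lim)
  with lr show "(f \<longlongrightarrow> rlim f x0) left_end" "(f \<longlongrightarrow> llim f x1) right_end" by auto
qed

text \<open>The bounds \<open>m\<close> and \<open>B\<close> are parameters because the stability
  estimate needs them uniform along a sequence, whereas membership in \<open>Reg_pos\<close> gives
  bounds that vary with the function.\<close>

definition coefficient :: "real \<Rightarrow> real \<Rightarrow> (real \<Rightarrow> complex) \<Rightarrow> complex \<Rightarrow> complex \<Rightarrow> bool" where
  "coefficient m B \<zeta> z0 z1 \<longleftrightarrow> 0 < m \<and> \<zeta> \<in> borel_measurable M \<and>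
     (AE x in M. Im (\<zeta> x) = 0 \<and> m \<le> Re (\<zeta> x) \<and> cmod (\<zeta> x) \<le> B) \<and>
     (\<zeta> \<longlongrightarrow> z0) left_end \<and> (\<zeta> \<longlongrightarrow> z1) right_end"

lemma Reg_pos_coefficient:
  assumes "\<zeta> \<in> Reg_pos X"
  obtains m B where "coefficient m B \<zeta> (rlim \<zeta> x0) (llim \<zeta> x1)"
proof -
  have R: "\<zeta> \<in> Reg X" using assms by (simp add: Reg_pos_def)
  then have L: "\<zeta> \<in> Linf X" by (simp add: Reg_def)
  obtain B where "AE x in M. cmod (\<zeta> x) \<le> B" by (rule Linf_bounded[OF L])
  moreover obtain m where "m > 0" "AE x in M. \<zeta> x \<in> \<real> \<and> Re (\<zeta> x) > m"
    using assms unfolding Reg_pos_def by blast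
  ultimately have "coefficient m B \<zeta> (rlim \<zeta> x0) (llim \<zeta> x1)"
    unfolding coefficient_def using Reg_limits[OF R] Linf_measurable[OF L]
    by (auto simp: complex_is_Real_iff elim: eventually_elim2)
  then show ?thesis by (rule that)
qed

text \<open>Closed conditions survive a limit along a nontrivial filter. Nonvanishing of
  \<open>z0\<close> and \<open>z1\<close> permits division of the flux by the coefficient at the
  endpoints.\<close>

lemma coefficient_limits:
  assumes "coefficient m B \<zeta> z0 z1"
  shows "Im z0 = 0" "m \<le> Re z0" "cmod z0 \<le> B" "Im z1 = 0" "m \<le> Re z1" "cmod z1 \<le> B" "z0 \<noteq> 0" "z1 \<noteq> 0" "m \<le> B"
proof -
  have ae: "AE x in M. Im (\<zeta> x) = 0 \<and> m \<le> Re (\<zeta> x) \<and> cmod (\<zeta> x) \<le> B" and m: "0 < m"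
    and l: "(\<zeta> \<longlongrightarrow> z0) left_end" "(\<zeta> \<longlongrightarrow> z1) right_end" using assms by (auto simp: coefficient_def)
  have *: "Im z = 0 \<and> m \<le> Re z \<and> cmod z \<le> B" if F: "F \<noteq> bot" "(\<zeta> \<longlongrightarrow> z) F"
      "\<forall>\<^sub>F x in F. Im (\<zeta> x) = 0 \<and> m \<le> Re (\<zeta> x) \<and> cmod (\<zeta> x) \<le> B" for F z
  proof (intro conjI)
    have "((\<lambda>x. Im (\<zeta> x)) \<longlongrightarrow> 0) F" using F(3) by (intro tendsto_eventually) (auto elim: eventually_mono)
    with tendsto_Im[OF F(2)] show "Im z = 0" using F(1) tendsto_unique by blast
    show "m \<le> Re z"
      by (rule tendsto_lowerbound[OF tendsto_Re[OF F(2)] _ F(1)]) (use F(3) in \<open>auto elim: eventually_mono\<close>)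
    show "cmod z \<le> B"
      by (rule tendsto_upperbound[OF tendsto_norm[OF F(2)] _ F(1)]) (use F(3) in \<open>auto elim: eventually_mono\<close>)
  qed
  from *[OF left_end_nontrivial l(1) AE_imp_left_end[OF ae]] *[OF right_end_nontrivial l(2) AE_imp_right_end[OF ae]]
  show "Im z0 = 0" "m \<le> Re z0" "cmod z0 \<le> B" "Im z1 = 0" "m \<le> Re z1" "cmod z1 \<le> B" "z0 \<noteq> 0" "z1 \<noteq> 0" "m \<le> B"
    using m complex_Re_le_cmod[of z0] by auto
qed

lemma coefficient_mono: "coefficient m B \<zeta> z0 z1 \<Longrightarrow> 0 < m' \<Longrightarrow> m' \<le> m \<Longrightarrow> B \<le> B' \<Longrightarrow> coefficient m' B' \<zeta> z0 z1"
  unfolding coefficient_def by (elim conjE, intro conjI, assumption+) (elim eventually_mono, simp, assumption+)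

text \<open>Exchanges the bounds \<open>m'\<close> and \<open>B'\<close>, which might degenerate
  along a sequence, for bounds determined by \<open>\<zeta>\<close>. The threshold
  \<open>m / 2\<close> preserves half of the lower bound.\<close>

lemma coefficient_perturb:
  assumes z: "coefficient m B \<zeta> z0 z1" and z': "coefficient m' B' \<zeta>' z0' z1'"
    and e: "AE x in M. cmod (\<zeta>' x - \<zeta> x) \<le> e" "e \<le> m / 2"
  shows "coefficient (m/2) (B + m) \<zeta>' z0' z1'" "cmod (z0' - z0) \<le> e" "cmod (z1' - z1) \<le> e"
proof -
  have m: "m > 0" and l: "(\<zeta> \<longlongrightarrow> z0) left_end" "(\<zeta> \<longlongrightarrow> z1) right_end" using z by (auto simp: coefficient_def)
  have l': "(\<zeta>' \<longlongrightarrow> z0') left_end" "(\<zeta>' \<longlongrightarrow> z1') right_end" using z' by (auto simp: coefficient_def)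
  have "AE x in M. Im (\<zeta> x) = 0 \<and> m \<le> Re (\<zeta> x) \<and> cmod (\<zeta> x) \<le> B"
     "AE x in M. Im (\<zeta>' x) = 0 \<and> m' \<le> Re (\<zeta>' x) \<and> cmod (\<zeta>' x) \<le> B'"
     using z z' by (auto simp: coefficient_def)
  with e(1) have "AE x in M. Im (\<zeta>' x) = 0 \<and> m / 2 \<le> Re (\<zeta>' x) \<and> cmod (\<zeta>' x) \<le> B + m"
  proof eventually_elim
    case (elim x)
    have "\<bar>Re (\<zeta>' x - \<zeta> x)\<bar> \<le> e" using elim(1) abs_Re_le_cmod order_trans by blast
    then have "m / 2 \<le> Re (\<zeta>' x)" using elim e(2) by (simp add: abs_le_iff)
    moreover have "cmod (\<zeta>' x) \<le> B + m" using elim e(2) m norm_triangle_sub[of "\<zeta>' x" "\<zeta> x"] by auto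
    ultimately show ?case using elim by simp
  qed
  then show "coefficient (m/2) (B + m) \<zeta>' z0' z1'" using z' m by (simp add: coefficient_def)
  show "cmod (z0' - z0) \<le> e"
    by (rule tendsto_upperbound[OF tendsto_norm[OF tendsto_diff[OF l'(1) l(1)]] AE_imp_left_end[OF e(1)] left_end_nontrivial])
  show "cmod (z1' - z1) \<le> e"
    by (rule tendsto_upperbound[OF tendsto_norm[OF tendsto_diff[OF l'(2) l(2)]] AE_imp_right_end[OF e(1)] right_end_nontrivial])
qed

section \<open>Weak solutions and their flux\<close>

lemma coefficient_mult_L2:
  assumes "coefficient m B \<zeta> z0 z1" "f \<in> L2 X" shows "(\<lambda>x. \<zeta> x * f x) \<in> L2 X"
  by (rule L2_bounded_mult[of _ B]) (use assms in \<open>auto simp: coefficient_def\<close>)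

lemma coefficient_form_integrable:
  assumes "coefficient m B \<zeta> z0 z1" "f \<in> L2 X" "g \<in> L2 X"
  shows "integrable M (\<lambda>x. \<zeta> x * f x * cnj (g x))"
  by (intro L2_mult coefficient_mult_L2[OF assms(1)] L2_cnj assms)

lemma has_prim_const: "has_prim (\<lambda>x. c) c (\<lambda>x. 0)"
  by (simp add: has_prim_def const_L2)

lemma prim_const: "s \<in> {x0..x1} \<Longrightarrow> prim (\<lambda>x. c) s = of_real (s - x0) * c"
  by (simp add: scaleR_conv_of_real)

text \<open>The ramp vanishes at \<open>x1\<close>, so testing with it removes the impedance term;
  its derivative is minus the indicator that cuts an integral over \<open>X\<close> down to a
  primitive at \<open>a\<close>.\<close>

lemma has_prim_ramp:
  assumes a: "a \<in> {x0..x1}"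
  shows "has_prim (\<lambda>x. of_real (max 0 (a - x))) (of_real (a - x0)) (\<lambda>t. if t < a then - 1 else 0)"
  unfolding has_prim_def
proof (intro conjI AE_I2)
  show "(\<lambda>x. complex_of_real (max 0 (a - x))) \<in> borel_measurable M" by measurable
  have one: "integrable M (\<lambda>x. - 1 :: complex)" by simp
  note cut = integrable_cut[OF one]
  show "(\<lambda>t. if t < a then - 1 else 0) \<in> L2 X"
    by (rule bounded_L2[of _ 1]) (use cut in auto)
  fix x assume x: "x \<in> space M"
  have "prim (\<lambda>t. if t < a then - 1 else 0) x = (LINT t|M. (if t < min a x then - 1 else 0))"
    using x by (subst prim_eq_lebesgue[OF cut]) (auto intro!: Bochner_Integration.integral_cong)
  also have "\<dots> = prim (\<lambda>t. - 1) (min a x)"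
    using x by (intro prim_eq_lebesgue[OF one, symmetric]) auto
  also have "\<dots> = - of_real (min a x - x0)"
    using x a by (subst prim_const) auto
  finally show "complex_of_real (max 0 (a - x)) = of_real (a - x0) + prim (\<lambda>t. if t < a then - 1 else 0) x"
    by (auto simp: min_def max_def)
qed

text \<open>The ramp at \<open>t\<close> is the length of the set of \<open>s\<close> with
  \<open>t < s < a\<close>; exchanging the integrations produces the second primitive.\<close>

lemma integral_mult_ramp:
  assumes f: "integrable M f" and a: "a \<in> {x0..x1}"
  shows "(LINT t|M. f t * of_real (max 0 (a - t))) = prim (prim f) a"
proof -
  have one: "integrable M (\<lambda>x. 1 :: complex)" by simp
  have inner: "(LINT s|M. (if t < s then (if s < a then 1 else 0) else 0)) = complex_of_real (max 0 (a - t))"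
    if t: "t \<in> X" for t
  proof -
    have eq: "(\<lambda>s. if t < s then (if s < a then 1 else 0) else 0 :: complex) = (\<lambda>s. if s \<in> {t<..<a} then 1 else 0)"
      by auto
    have "integrable M (\<lambda>s. if t < s then (if s < a then 1 else 0) else 0 :: complex)"
      by (rule bounded_integrable[of _ 1]) (auto intro!: measurable_If borel_measurable_less)
    then have "(LINT s|M. (if t < s then (if s < a then 1 else 0) else 0)) = integral X (\<lambda>s. if s \<in> {t<..<a} then 1 else 0 :: complex)"
      unfolding eq by (rule lebesgue_integral_eq_integral) simp
    also have "\<dots> = integral ({t<..<a} \<inter> X) (\<lambda>s. 1)" by (rule integral_restrict_Int)
    also have "{t<..<a} \<inter> X = {t<..<a}" using t a by auto
    also have "integral {t<..<a} (\<lambda>s. 1 :: complex) = integral {t..a} (\<lambda>s. 1)" by (rule integral_open_interval_real[symmetric])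
    also have "\<dots> = complex_of_real (max 0 (a - t))"
      by (cases "t \<le> a") (auto simp: scaleR_conv_of_real)
    finally show ?thesis .
  qed
  have "(LINT t|M. f t * of_real (max 0 (a - t))) =
      (LINT t|M. f t * (LINT s|M. (if t < s then (if s < a then 1 else 0) else 0)))"
    by (intro Bochner_Integration.integral_cong) (simp_all only: inner space_lebesgue_on)
  also have "\<dots> = (LINT s|M. prim f s * (if s < a then 1 else 0))"
    by (rule Fubini_prim[where B=1, OF f borel_measurable_integrable[OF integrable_cut[OF one]]]) auto
  also have "\<dots> = (LINT s|M. (if s < a then prim f s else 0))"
    by (intro Bochner_Integration.integral_cong) auto
  also have "\<dots> = prim (prim f) a"
    using a by (intro prim_eq_lebesgue[symmetric] continuous_integrable prim_continuous f) auto
  finally show ?thesis .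
qed

section \<open>Zero as an exceptional frequency\<close>

text \<open>The constant $1$ is an eigenfunction of the operator \<^const>\<open>A0\<close> with eigenvalue $1$.\<close>

lemma zero_in_exceptional_set:
  assumes z: "coefficient m B \<zeta> z0 z1" shows "0 \<in> exceptional_set X \<zeta>"
proof -
  \<comment> \<open>The condition under the \<open>SOME\<close> of \<open>A0\<close> for the
    argument 1. The constant 1 satisfies it, hence so does the chosen \<open>\<phi>\<close>; that
    \<open>\<phi>\<close> equals 1 almost everywhere still needs a uniqueness argument.\<close>
  define P where "P = (\<lambda>\<phi>. \<phi> \<in> W12 X \<and>
     (\<forall>v\<in>W12 X. inner_L2 X (\<lambda>x. \<zeta> x * \<phi> x) v + inner_L2 X (\<lambda>x. \<zeta> x * wderiv X \<phi> x) (wderiv X v)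
              = inner_L2 X (\<lambda>x. \<zeta> x * 1) v))"
  define \<phi> where "\<phi> = A0 X \<zeta> (\<lambda>x. 1)"
  define g where "g = wderiv X \<phi>"
  note \<zeta>_meas [measurable] = z[unfolded coefficient_def, THEN conjunct2, THEN conjunct1]
  have ae: "AE x in M. Im (\<zeta> x) = 0 \<and> m \<le> Re (\<zeta> x)" and m: "m > 0"
    using z by (auto simp: coefficient_def)
  have "P (\<lambda>x. 1)" unfolding P_def
  proof (intro conjI ballI)
    show "(\<lambda>x. 1) \<in> W12 X" by (rule has_prim_W12[OF has_prim_const])
    fix v assume v: "v \<in> W12 X"
    have "AE x in M. \<zeta> x * wderiv X (\<lambda>x. 1) x * cnj (wderiv X v x) = 0"
      using has_prim_wderiv(2)[OF has_prim_const[of 1]] by eventually_elim simp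
    then have "inner_L2 X (\<lambda>x. \<zeta> x * wderiv X (\<lambda>x. 1) x) (wderiv X v) = 0"
      unfolding inner_L2_def by (rule integral_eq_zero_AE)
    then show "inner_L2 X (\<lambda>x. \<zeta> x * 1) v + inner_L2 X (\<lambda>x. \<zeta> x * wderiv X (\<lambda>x. 1) x) (wderiv X v)
              = inner_L2 X (\<lambda>x. \<zeta> x * 1) v" by simp
  qed
  then have "P (SOME \<phi>. P \<phi>)" by (rule someI[of P])
  moreover have "\<phi> = (SOME \<phi>. P \<phi>)" by (simp only: \<phi>_def A0_def P_def)
  ultimately have P: "P \<phi>" by simp
  then obtain c where c: "has_prim \<phi> c g" unfolding g_def P_def using W12_has_prim by blast
  note d = has_prim_diff[OF c has_prim_const[of 1]]
  let ?d = "\<lambda>x. \<phi> x - 1"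
  have L2: "\<phi> \<in> L2 X" "?d \<in> L2 X" "g \<in> L2 X"
    using has_prim_L2[OF c] has_prim_L2[OF d] c by (auto simp: has_prim_def)
  note [measurable] = L2[THEN L2_measurable]
  have [measurable]: "wderiv X ?d \<in> borel_measurable M"
    using has_prim_wderiv(1)[OF d] by (auto simp: has_prim_def L2_measurable)
  \<comment> \<open>Testing with \<open>\<phi> - 1\<close>, whose derivative is \<open>g\<close>
    almost everywhere, turns the equation into a sum of two quadratic forms equal to zero.\<close>
  have "inner_L2 X (\<lambda>x. \<zeta> x * \<phi> x) ?d + inner_L2 X (\<lambda>x. \<zeta> x * g x) (wderiv X ?d) = inner_L2 X (\<lambda>x. \<zeta> x * 1) ?d"
    using P has_prim_W12[OF d] unfolding P_def g_def by blast
  moreover have "inner_L2 X (\<lambda>x. \<zeta> x * g x) (wderiv X ?d) = (LINT x|M. \<zeta> x * g x * cnj (g x))"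
    unfolding inner_L2_def
  proof (rule integral_cong_AE)
    show "AE x in M. \<zeta> x * g x * cnj (wderiv X ?d x) = \<zeta> x * g x * cnj (g x)"
      using has_prim_wderiv(2)[OF d] by eventually_elim simp
  qed (use L2 in \<open>auto intro!: borel_measurable_times L2_measurable[OF L2_cnj] simp: has_prim_wderiv(1)[OF d, unfolded has_prim_def]\<close>)
  moreover have "inner_L2 X (\<lambda>x. \<zeta> x * \<phi> x) ?d - inner_L2 X (\<lambda>x. \<zeta> x * 1) ?d = (LINT x|M. \<zeta> x * ?d x * cnj (?d x))"
    using coefficient_form_integrable[OF z L2(1,2)] coefficient_form_integrable[OF z const_L2[of 1] L2(2)]
    unfolding inner_L2_def by (subst Bochner_Integration.integral_diff[symmetric]) (auto simp: algebra_simps)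
  ultimately have "(LINT x|M. \<zeta> x * ?d x * cnj (?d x)) + (LINT x|M. \<zeta> x * g x * cnj (g x)) = 0"
    by (simp add: algebra_simps)
  moreover have i: "integrable M (\<lambda>x. \<zeta> x * ?d x * cnj (?d x))" "integrable M (\<lambda>x. \<zeta> x * g x * cnj (g x))"
    by (intro coefficient_form_integrable[OF z] L2)+
  ultimately have int: "(LINT x|M. \<zeta> x * ?d x * cnj (?d x) + \<zeta> x * g x * cnj (g x)) = 0" by simp
  define T where "T = (\<lambda>x. \<zeta> x * ?d x * cnj (?d x) + \<zeta> x * g x * cnj (g x))"
  have iT: "integrable M (\<lambda>x. Re (T x))" unfolding T_def using i by (intro integrable_Re) simp
  \<comment> \<open>Coercivity: \<open>\<zeta>\<close> is real and at least \<open>m\<close>, so a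
    vanishing total forces \<open>\<phi>\<close> to be 1 almost everywhere.\<close>
  have re: "AE x in M. m * (cmod (?d x))\<^sup>2 \<le> Re (T x)"
    using ae
  proof eventually_elim
    case (elim x)
    then have *: "\<zeta> x = of_real (Re (\<zeta> x))" by (simp add: complex_eq_iff)
    have "Re (\<zeta> x * w * cnj w) = Re (\<zeta> x) * (cmod w)\<^sup>2" for w
      unfolding cmod_power2 by (subst *) (simp add: power2_eq_square algebra_simps)
    moreover have "m * (cmod (?d x))\<^sup>2 \<le> Re (\<zeta> x) * (cmod (?d x))\<^sup>2" "0 \<le> Re (\<zeta> x) * (cmod (g x))\<^sup>2"
      using elim m by (auto intro!: mult_right_mono)
    ultimately show ?case unfolding T_def by (simp only: plus_complex.simps)
  qed
  have nonneg: "AE x in M. 0 \<le> Re (T x)"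
    using re by eventually_elim (use m in \<open>meson less_imp_le mult_nonneg_nonneg order_trans zero_le_power2\<close>)
  have "(LINT x|M. Re (T x)) = Re (LINT x|M. T x)"
    unfolding T_def using i by (intro integral_Re) simp
  also have "\<dots> = 0" using int unfolding T_def by simp
  finally have "AE x in M. Re (T x) = 0"
    using integral_nonneg_eq_0_iff_AE[OF iT nonneg] by simp
  with re have "AE x in M. (cmod (?d x))\<^sup>2 = 0"
    by eventually_elim (use m in \<open>auto simp: mult_le_0_iff\<close>)
  then have null: "norm_L2 X (\<lambda>x. A0 X \<zeta> (\<lambda>x. 1) x - of_real 1 * 1) = 0"
    unfolding norm_L2_def \<phi>_def[symmetric] by (simp add: integral_eq_zero_AE)
  have pos: "norm_L2 X (\<lambda>x. 1) > 0"
    using x0_less_x1 by (simp add: norm_L2_def measure_restrict_space)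
  \<comment> \<open>The constant 1 has positive norm but zero residual, which contradicts the lower
    bound for every \<open>C\<close>.\<close>
  have "\<not> (\<exists>C. \<forall>\<psi>\<in>L2 X. norm_L2 X \<psi> \<le> C * norm_L2 X (\<lambda>x. A0 X \<zeta> \<psi> x - of_real 1 * \<psi> x))"
  proof
    assume "\<exists>C. \<forall>\<psi>\<in>L2 X. norm_L2 X \<psi> \<le> C * norm_L2 X (\<lambda>x. A0 X \<zeta> \<psi> x - of_real 1 * \<psi> x)"
    then obtain C where "norm_L2 X (\<lambda>x. 1) \<le> C * norm_L2 X (\<lambda>x. A0 X \<zeta> (\<lambda>x. 1) x - of_real 1 * 1)"
      using const_L2[of 1] by blast
    then show False using null pos by simp
  qed
  then have "complex_of_real 1 \<in> spectrum_L2 X (A0 X \<zeta>)" unfolding spectrum_L2_def by blast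
  then show ?thesis unfolding exceptional_set_def by (intro CollectI exI[of _ 1]) auto
qed

text \<open>Rewrites the weak equation with explicit representatives: any derivatives
  \<open>g\<close> and \<open>h\<close> in place of \<open>wderiv\<close>, endpoint values in place
  of essential limits. Concrete test functions can then be inserted directly.\<close>

lemma weak_solution_test:
  assumes w: "weak_solution x0 x1 \<xi> \<omega> \<zeta> \<psi>" and z: "coefficient m B \<zeta> (rlim \<zeta> x0) (llim \<zeta> x1)"
    and \<psi>: "has_prim \<psi> c g" and v: "has_prim v d h"
  shows "(of_real \<omega>)\<^sup>2 * (LINT x|M. \<zeta> x * \<psi> x * cnj (v x)) - (LINT x|M. \<zeta> x * g x * cnj (h x))
     + \<i> * of_real \<omega> * (rlim \<zeta> x0 * c * cnj d
        + llim \<zeta> x1 * ((1 - \<xi>) / (1 + \<xi>)) * (c + prim g x1) * cnj (d + prim h x1))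
     = 2 * \<i> * of_real \<omega> * rlim \<zeta> x0 * cnj d"
proof -
  have "inner_L2 X (\<lambda>x. \<zeta> x * wderiv X \<psi> x) (wderiv X v) = (LINT x|M. \<zeta> x * g x * cnj (h x))"
    unfolding inner_L2_def
  proof (rule integral_cong_AE)
    show "AE x in M. \<zeta> x * wderiv X \<psi> x * cnj (wderiv X v x) = \<zeta> x * g x * cnj (h x)"
      using has_prim_wderiv(2)[OF \<psi>] has_prim_wderiv(2)[OF v] by eventually_elim simp
    show "(\<lambda>x. \<zeta> x * wderiv X \<psi> x * cnj (wderiv X v x)) \<in> borel_measurable M"
      using has_prim_wderiv(1)[OF \<psi>] has_prim_wderiv(1)[OF v]
      by (intro borel_measurable_integrable coefficient_form_integrable[OF z]) (auto simp: has_prim_def)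
    show "(\<lambda>x. \<zeta> x * g x * cnj (h x)) \<in> borel_measurable M"
      using \<psi> v by (intro borel_measurable_integrable coefficient_form_integrable[OF z]) (auto simp: has_prim_def)
  qed
  then show ?thesis
    using w has_prim_W12[OF v] has_prim_limits(3,4)[OF \<psi>] has_prim_limits(3,4)[OF v]
    unfolding weak_solution_def Let_def by (auto simp: inner_L2_def)
qed

text \<open>The right-hand side is what testing with the ramps $(a-t)^+$ yields for $\zeta\psi'$; it needs no derivative.\<close>

definition flux :: "real \<Rightarrow> (real \<Rightarrow> complex) \<Rightarrow> (real \<Rightarrow> complex) \<Rightarrow> complex \<Rightarrow> real \<Rightarrow> complex" where
  "flux \<omega> \<zeta> \<psi> c x = \<i> * of_real \<omega> * rlim \<zeta> x0 * (2 - c) - (of_real \<omega>)\<^sup>2 * prim (\<lambda>t. \<zeta> t * \<psi> t) x"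

lemma flux_continuous:
  assumes "coefficient m B \<zeta> z0 z1" "\<psi> \<in> L2 X"
  shows "continuous_on {x0..x1} (flux \<omega> \<zeta> \<psi> c)"
  unfolding flux_def
  by (intro continuous_on_diff continuous_on_const continuous_on_mult prim_continuous L2_integrable[OF coefficient_mult_L2[OF assms]])

text \<open>Ramps give the first identity only after integration up to \<open>a\<close>, for every
  \<open>a\<close> in \<open>X\<close>; a vanishing primitive then gives it almost everywhere. The
  constant test function has no derivative term, so it links both endpoint terms to the integral of
  \<open>\<zeta> * \<psi>\<close>, which is the flux at \<open>x1\<close>.\<close>

lemma weak_solution_flux:
  assumes w: "weak_solution x0 x1 \<xi> \<omega> \<zeta> \<psi>" and z: "coefficient m B \<zeta> (rlim \<zeta> x0) (llim \<zeta> x1)"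
    and \<psi>: "has_prim \<psi> c g"
  shows "AE x in M. \<zeta> x * g x = flux \<omega> \<zeta> \<psi> c x"
    and "flux \<omega> \<zeta> \<psi> c x1 = \<i> * of_real \<omega> * llim \<zeta> x1 * ((1 - \<xi>) / (1 + \<xi>)) * (c + prim g x1)"
proof -
  have g: "g \<in> L2 X" and \<psi>2: "\<psi> \<in> L2 X" using \<psi> has_prim_L2[OF \<psi>] by (auto simp: has_prim_def)
  have i: "integrable M (\<lambda>t. \<zeta> t * \<psi> t)" "integrable M (\<lambda>t. \<zeta> t * g t)"
    by (intro L2_integrable coefficient_mult_L2[OF z] g \<psi>2)+
  let ?f = "\<lambda>t. \<zeta> t * \<psi> t"
  note cf = flux_continuous[OF z \<psi>2, of \<omega> c]
  show "flux \<omega> \<zeta> \<psi> c x1 = \<i> * of_real \<omega> * llim \<zeta> x1 * ((1 - \<xi>) / (1 + \<xi>)) * (c + prim g x1)"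
    using weak_solution_test[OF w z \<psi> has_prim_const[of 1]] prim_x1[OF i(1)]
    by (simp add: flux_def algebra_simps)
  have "AE x in M. \<zeta> x * g x - flux \<omega> \<zeta> \<psi> c x = 0"
  proof (rule prim_zero_imp_AE_zero)
    show "integrable M (\<lambda>x. \<zeta> x * g x - flux \<omega> \<zeta> \<psi> c x)"
      using i continuous_integrable[OF cf] by simp
    fix a assume "a \<in> X"
    then have a: "a \<in> {x0..x1}" "a \<le> x1" by auto
    have ip: "integrable M (prim ?f)" by (intro continuous_integrable prim_continuous i)
    have "prim (flux \<omega> \<zeta> \<psi> c) a = prim (\<lambda>x. \<i> * of_real \<omega> * rlim \<zeta> x0 * (2 - c)) a - prim (\<lambda>x. (of_real \<omega>)\<^sup>2 * prim ?f x) a"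
      unfolding flux_def[abs_def] using ip a(2) by (intro prim_diff) auto
    also have "\<dots> = of_real (a - x0) * (\<i> * of_real \<omega> * rlim \<zeta> x0 * (2 - c)) - (of_real \<omega>)\<^sup>2 * prim (prim ?f) a"
      unfolding prim_const[OF a(1)] by simp
    finally have 1: "prim (flux \<omega> \<zeta> \<psi> c) a = \<dots>" .
    \<comment> \<open>The value of the ramp at \<open>x1\<close>, in the form in which
      \<open>weak_solution_test\<close> presents it.\<close>
    have e: "(of_real (a - x0) :: complex) + prim (\<lambda>t. if t < a then - 1 else 0) x1 = 0"
    proof -
      have "prim (\<lambda>t. if t < a then - 1 else (0::complex)) x1 = (LINT t|M. (if t < a then - 1 else 0))"
        by (intro prim_x1 integrable_cut) simp
      also have "\<dots> = prim (\<lambda>t. - 1) a"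
        using a by (intro prim_eq_lebesgue[symmetric]) auto
      finally show ?thesis using prim_const[OF a(1), of "- 1"] by simp
    qed
    from weak_solution_test[OF w z \<psi> has_prim_ramp[OF a(1)], unfolded e]
    have "(of_real \<omega>)\<^sup>2 * (LINT x|M. ?f x * of_real (max 0 (a - x))) - (LINT x|M. \<zeta> x * g x * cnj (if x < a then - 1 else 0))
        + \<i> * of_real \<omega> * (rlim \<zeta> x0 * c * of_real (a - x0)) = 2 * \<i> * of_real \<omega> * rlim \<zeta> x0 * of_real (a - x0)"
      by simp
    moreover have "(LINT x|M. \<zeta> x * g x * cnj (if x < a then - 1 else 0)) = - prim (\<lambda>x. \<zeta> x * g x) a"
    proof -
      have "(LINT x|M. \<zeta> x * g x * cnj (if x < a then - 1 else 0)) = (LINT x|M. - (if x < a then \<zeta> x * g x else 0))"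
        by (intro Bochner_Integration.integral_cong) auto
      then show ?thesis unfolding prim_eq_lebesgue[OF i(2) a(2)] by simp
    qed
    ultimately have "prim (\<lambda>x. \<zeta> x * g x) a = of_real (a - x0) * (\<i> * of_real \<omega> * rlim \<zeta> x0 * (2 - c)) - (of_real \<omega>)\<^sup>2 * prim (prim ?f) a"
      unfolding integral_mult_ramp[OF i(1) a(1)] by (simp add: algebra_simps)
    then show "prim (\<lambda>x. \<zeta> x * g x - flux \<omega> \<zeta> \<psi> c x) a = 0"
      using prim_diff[OF i(2) continuous_integrable[OF cf] a(2)] 1 by simp
  qed
  then show "AE x in M. \<zeta> x * g x = flux \<omega> \<zeta> \<psi> c x" by simp
qed

section \<open>Stability\<close>

text \<open>The factor 2 and the exponent \<open>2 * K\<close> are not sharp. What counts later is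
  linearity in \<open>a\<close>, with a factor that depends only on \<open>K\<close> and the length
  of the interval.\<close>

lemma Gronwall:
  fixes h :: "real \<Rightarrow> real"
  assumes h: "continuous_on {x0..x1} h" and K: "0 < K" and a: "0 \<le> a"
    and le: "\<And>x. x \<in> {x0..x1} \<Longrightarrow> h x \<le> a + K * integral {x0..x} h"
    and x: "x \<in> {x0..x1}"
  shows "h x \<le> 2 * a * exp (2 * K * (x1 - x0))"
proof -
  \<comment> \<open>In the sup norm with weight $e^{-2K(t-x_0)}$ the integral operator has norm at most $1/2$.\<close>
  let ?E = "\<lambda>t. exp (2 * K * (t - x0))"
  have "continuous_on {x0..x1} (\<lambda>t. h t / ?E t)" by (intro continuous_intros h) auto
  then obtain y where y: "y \<in> {x0..x1}" and max: "\<And>t. t \<in> {x0..x1} \<Longrightarrow> h t / ?E t \<le> h y / ?E y"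
    using continuous_attains_sup[of "{x0..x1}" "\<lambda>t. h t / ?E t"] x by auto
  define n where "n = h y / ?E y"
  have hn: "h t \<le> n * ?E t" if "t \<in> {x0..x1}" for t
    using max[OF that] by (simp add: n_def[symmetric] pos_divide_le_eq)
  have "n \<le> 2 * a"
  \<comment> \<open>\<open>h\<close> may be negative; a nonpositive weighted maximum lies below
    \<open>2 * a\<close> at once.\<close>
  proof (cases "n \<le> 0")
    case False
    have hi: "((\<lambda>t. n * ?E t) has_integral n * ?E y / (2 * K) - n * ?E x0 / (2 * K)) {x0..y}"
      using y K by (intro fundamental_theorem_of_calculus) (auto intro!: derivative_eq_intros simp flip: has_real_derivative_iff_has_vector_derivative)
    have "integral {x0..y} h \<le> integral {x0..y} (\<lambda>t. n * ?E t)"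
      using h y hn by (intro integral_le integrable_continuous_real has_integral_integrable[OF hi]) (auto elim: continuous_on_subset)
    also have "\<dots> = n * ?E y / (2 * K) - n / (2 * K)" unfolding integral_unique[OF hi] by simp
    finally have "K * integral {x0..y} h \<le> K * (n * ?E y / (2 * K) - n / (2 * K))"
      using K by (intro mult_left_mono) auto
    also have "\<dots> = n * ?E y / 2 - n / 2" using K by (simp add: field_simps)
    finally have "h y \<le> a + (n * ?E y / 2 - n / 2)" using le[OF y] by linarith
    moreover have "h y = n * ?E y" by (simp add: n_def)
    ultimately have "n * ?E y \<le> 2 * a" using False by simp
    moreover have "n * 1 \<le> n * ?E y" using False y K by (intro mult_left_mono) auto
    ultimately show ?thesis by simp
  qed (use a in simp)
  then have "n * ?E x \<le> 2 * a * ?E x" by (intro mult_right_mono) auto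
  also have "\<dots> \<le> 2 * a * exp (2 * K * (x1 - x0))"
    using x K a by (intro mult_left_mono) auto
  finally show ?thesis using hn[OF x] by simp
qed

end

text \<open>Absorption: if \<open>S\<close> exceeded the bound, then \<open>e \<le> S\<close>, so
  the term with \<open>e\<^sup>2\<close> is at most \<open>q * e * S\<close> and the right side
  falls strictly below \<open>S\<^sup>2\<close>. The summand 1 ensures both \<open>e \<le> S\<close>
  and strictness.\<close>

lemma quadratic_bound:
  fixes S p q e :: real
  assumes "S\<^sup>2 \<le> p * e * S + q * e\<^sup>2" "0 \<le> p" "0 \<le> q" "0 \<le> e" "0 \<le> S"
  shows "S \<le> (p + q + 1) * e"
proof (rule ccontr)
  assume "\<not> ?thesis"
  then have *: "(p + q + 1) * e < S" by simp
  have "e \<le> (p + q + 1) * e" using assms by (simp add: algebra_simps)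
  then have "e \<le> S" using * by simp
  then have "e * e \<le> e * S" using assms(4) by (rule mult_left_mono)
  then have "q * e\<^sup>2 \<le> q * (e * S)"
    using assms(3) unfolding power2_eq_square by (rule mult_left_mono)
  then have "S * S \<le> ((p + q) * e) * S" using assms(1) by (simp add: algebra_simps power2_eq_square)
  moreover have "(p + q) * e \<le> (p + q + 1) * e" "0 \<le> (p + q + 1) * e"
    using assms by (auto intro!: mult_right_mono)
  with * have "((p + q) * e) * S < S * S" by (intro mult_strict_right_mono) linarith+
  ultimately show False by simp
qed

text \<open>\<open>\<alpha>\<close> and \<open>\<beta>\<close> are the factors of the initial
  difference and of \<open>e\<close> in the Gronwall bound; \<open>\<gamma>\<close> and
  \<open>\<delta>\<close> are the factors of \<open>e * S\<close> and \<open>e\<^sup>2\<close> in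
  the energy bound. The result is the factor \<open>p + q + 1\<close> of
  \<open>quadratic_bound\<close>.\<close>

definition (in bounded_interval) stability_constant :: "real \<Rightarrow> complex \<Rightarrow> real \<Rightarrow> real \<Rightarrow> real \<Rightarrow> real" where
  "stability_constant \<omega> \<xi> m B N =
    (let len = x1 - x0;
         E = exp (2 * (1 / m + \<omega>\<^sup>2 * B) * len);
         \<alpha> = 2 * (1 + \<bar>\<omega>\<bar> * B) * E;
         \<beta> = 2 * (len / m + \<bar>\<omega>\<bar> + \<omega>\<^sup>2 * len) * N * E;
         \<gamma> = (\<omega>\<^sup>2 * len + len / m + \<bar>\<omega>\<bar> + \<bar>\<omega>\<bar> * cmod ((1 - \<xi>) / (1 + \<xi>))) * N;
         \<delta> = N\<^sup>2 * len / m
     in 2 * \<alpha>\<^sup>2 * \<gamma> / (\<bar>\<omega>\<bar> * m) + (2 * \<alpha>\<^sup>2 * \<delta> / (\<bar>\<omega>\<bar> * m) + 2 * \<beta>\<^sup>2) + 1)"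

text \<open>The Cayley transform maps the unit disk to the right half-plane: the real part is
  \<open>1 - (cmod \<xi>)\<^sup>2\<close> divided by
  \<open>(cmod (1 + \<xi>))\<^sup>2\<close>.\<close>

lemma Re_impedance_pos:
  assumes "cmod \<xi> < 1" shows "0 < Re ((1 - \<xi>) / (1 + \<xi>))"
proof -
  have n: "1 + \<xi> \<noteq> 0"
  proof
    assume "1 + \<xi> = 0"
    then have "\<xi> = - 1" by (simp add: eq_neg_iff_add_eq_0 add.commute)
    then show False using assms by simp
  qed
  have "(Re \<xi>)\<^sup>2 + (Im \<xi>)\<^sup>2 < 1" using assms by (simp add: cmod_def)
  moreover have "0 < (1 + Re \<xi>)\<^sup>2 + (Im \<xi>)\<^sup>2" using n by (simp add: complex_eq_iff sum_power2_gt_zero_iff)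
  ultimately show ?thesis by (simp add: Re_divide power2_eq_square algebra_simps zero_less_divide_iff)
qed

text \<open>The unprimed solution is the limit, the primed one a member of the sequence. All bounds
  by \<open>N\<close> concern the unprimed solution and \<open>m\<close>, \<open>B\<close> serve
  both coefficients, so the estimates are uniform over late members.\<close>

locale two_solutions = bounded_interval +
  fixes \<omega> m B N e :: real and \<xi> :: complex and \<zeta> \<zeta>' \<psi> \<psi>' g g' :: "real \<Rightarrow> complex" and c c' :: complex
  assumes \<omega>: "\<omega> \<noteq> 0" and \<xi>: "cmod \<xi> < 1" and e: "0 \<le> e" and N: "0 \<le> N"
    and w: "weak_solution x0 x1 \<xi> \<omega> \<zeta> \<psi>" and w': "weak_solution x0 x1 \<xi> \<omega> \<zeta>' \<psi>'"
    and \<zeta>: "coefficient m B \<zeta> (rlim \<zeta> x0) (llim \<zeta> x1)"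
    and \<zeta>': "coefficient m B \<zeta>' (rlim \<zeta>' x0) (llim \<zeta>' x1)"
    and \<psi>: "has_prim \<psi> c g" and \<psi>': "has_prim \<psi>' c' g'"
    and \<psi>_le: "\<And>x. x \<in> {x0..x1} \<Longrightarrow> cmod (c + prim g x) \<le> N"
    and c_le: "cmod (2 - c) \<le> N"
    and g_le: "AE x in M. cmod (g x) \<le> N"
    and \<zeta>_near: "AE x in M. cmod (\<zeta>' x - \<zeta> x) \<le> e"
    and rlim_near: "cmod (rlim \<zeta>' x0 - rlim \<zeta> x0) \<le> e"
    and llim_near: "cmod (llim \<zeta>' x1 - llim \<zeta> x1) \<le> e"
begin

section \<open>Estimates for the difference of two solutions\<close>

abbreviation "len \<equiv> x1 - x0"
abbreviation "d x \<equiv> \<psi>' x - \<psi> x"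
abbreviation "k x \<equiv> g' x - g x"
text \<open>\<open>D\<close> is the continuous representative of \<open>d\<close>, so it can be
  evaluated at the endpoints and its supremum is attained; \<open>h\<close> is the quantity bounded
  by Gronwall.\<close>

definition "D x = c' - c + prim k x"
definition "q x = flux \<omega> \<zeta>' \<psi>' c' x - flux \<omega> \<zeta> \<psi> c x"
definition "h x = cmod (D x) + cmod (q x)"

lemma m: "0 < m" using \<zeta> by (simp add: coefficient_def)
lemma B: "0 < B" using coefficient_limits(9)[OF \<zeta>] m by simp

lemma has_prim_d: "has_prim d (c' - c) k" by (rule has_prim_diff[OF \<psi>' \<psi>])

lemma L2s: "\<psi> \<in> L2 X" "\<psi>' \<in> L2 X" "g \<in> L2 X" "g' \<in> L2 X" "d \<in> L2 X" "k \<in> L2 X"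
  using has_prim_L2[OF \<psi>] has_prim_L2[OF \<psi>'] has_prim_L2[OF has_prim_d] \<psi> \<psi>' has_prim_d by (auto simp: has_prim_def)

lemma AE_\<psi>: "AE x in M. cmod (\<psi> x) \<le> N"
proof -
  have "AE x in M. \<psi> x = c + prim g x" using \<psi> by (simp add: has_prim_def)
  then show ?thesis using AE_space by eventually_elim (use \<psi>_le in auto)
qed

lemma AE_d: "AE x in M. d x = D x"
  using has_prim_d by (simp add: has_prim_def D_def)

lemma D_continuous: "continuous_on {x0..x1} D"
  unfolding D_def by (intro affine_prim_continuous L2_integrable L2s)

lemma q_continuous: "continuous_on {x0..x1} q"
  unfolding q_def by (intro continuous_on_diff flux_continuous[OF \<zeta>] flux_continuous[OF \<zeta>'] L2s)

lemma h_continuous: "continuous_on {x0..x1} h"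
  unfolding h_def by (intro continuous_on_add continuous_on_norm q_continuous D_continuous)

lemma h_integrable: "x \<in> {x0..x1} \<Longrightarrow> h integrable_on {x0..x}"
  by (intro integrable_continuous_real continuous_on_subset[OF h_continuous]) auto

lemma integral_affine_h:
  assumes x: "x \<in> {x0..x1}"
  shows "integral {x0..x} (\<lambda>t. \<alpha> * h t + \<beta>) = \<alpha> * integral {x0..x} h + \<beta> * (x - x0)"
proof (rule integral_unique)
  have "((\<lambda>t. \<beta>) has_integral \<beta> * (x - x0)) {x0..x}"
    using has_integral_const_real[of \<beta> x0 x] x by (simp add: mult.commute)
  then show "((\<lambda>t. \<alpha> * h t + \<beta>) has_integral \<alpha> * integral {x0..x} h + \<beta> * (x - x0)) {x0..x}"
    by (intro has_integral_add has_integral_mult_right integrable_integral h_integrable x)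
qed

lemma AE_coefficient:
  "AE x in M. Im (\<zeta>' x) = 0 \<and> m \<le> Re (\<zeta>' x) \<and> m \<le> cmod (\<zeta>' x) \<and> cmod (\<zeta>' x) \<le> B"
proof -
  have "AE x in M. Im (\<zeta>' x) = 0 \<and> m \<le> Re (\<zeta>' x) \<and> cmod (\<zeta>' x) \<le> B" using \<zeta>' by (simp add: coefficient_def)
  then show ?thesis by eventually_elim (use complex_Re_le_cmod order_trans in blast)
qed

text \<open>Subtracting the two flux relations and dividing by \<open>\<zeta>'\<close> bounds the
  difference of the derivatives by that of the fluxes, with only the derivative of the limit
  solution in the error.\<close>

lemma AE_k: "AE x in M. cmod (k x) \<le> (cmod (q x) + e * N) / m"
  using weak_solution_flux(1)[OF w \<zeta> \<psi>] weak_solution_flux(1)[OF w' \<zeta>' \<psi>'] AE_coefficient g_le \<zeta>_near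
proof eventually_elim
  case (elim x)
  have "\<zeta>' x * k x = q x - (\<zeta>' x - \<zeta> x) * g x" using elim by (simp add: q_def algebra_simps)
  then have "cmod (\<zeta>' x) * cmod (k x) \<le> cmod (q x) + cmod (\<zeta>' x - \<zeta> x) * cmod (g x)"
    by (metis norm_mult norm_triangle_ineq4)
  also have "\<dots> \<le> cmod (q x) + e * N" using elim e by (intro add_left_mono mult_mono) auto
  finally have "m * cmod (k x) \<le> cmod (q x) + e * N"
    using elim by (meson mult_right_mono norm_ge_zero order_trans)
  then show ?case using m by (simp add: pos_le_divide_eq mult.commute)
qed

lemma D_le:
  assumes x: "x \<in> {x0..x1}"
  shows "cmod (D x) \<le> cmod (c' - c) + (1 / m) * integral {x0..x} h + e * N * len / m"
proof -
  have "cmod (prim k x) \<le> integral {x0..x} (\<lambda>t. (1 / m) * h t + e * N / m)"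
  proof (rule norm_prim_le)
    show "AE t in M. cmod (k t) \<le> (1 / m) * h t + e * N / m"
      using AE_k
    proof eventually_elim
      case (elim t)
      also have "(cmod (q t) + e * N) / m \<le> (h t + e * N) / m" using m by (intro divide_right_mono) (auto simp: h_def)
      finally show ?case by (simp add: add_divide_distrib)
    qed
  qed (use x m in \<open>auto intro!: L2_integrable L2s continuous_on_add continuous_on_divide continuous_on_const h_continuous\<close>)
  also have "\<dots> = (1 / m) * integral {x0..x} h + e * N / m * (x - x0)"
    by (rule integral_affine_h[OF x])
  also have "\<dots> \<le> (1 / m) * integral {x0..x} h + e * N / m * len"
    using x e N m by (intro add_left_mono mult_left_mono) auto
  finally show ?thesis unfolding D_def using norm_triangle_ineq[of "c' - c" "prim k x"] by simp
qed

text \<open>The initial flux is an explicit affine function of the initial value, so the difference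
  at \<open>x0\<close> is bounded by \<open>c' - c\<close> and \<open>e\<close>; the integral of
  \<open>\<zeta>' * \<psi>' - \<zeta> * \<psi>\<close> accounts for the rest.\<close>

lemma q_le:
  assumes x: "x \<in> {x0..x1}"
  shows "cmod (q x) \<le> \<bar>\<omega>\<bar> * (e * N + B * cmod (c' - c)) + \<omega>\<^sup>2 * (B * integral {x0..x} h + e * N * len)"
proof -
  let ?f = "\<lambda>t. \<zeta>' t * \<psi>' t - \<zeta> t * \<psi> t"
  have i: "integrable M (\<lambda>t. \<zeta>' t * \<psi>' t)" "integrable M (\<lambda>t. \<zeta> t * \<psi> t)"
    by (intro L2_integrable coefficient_mult_L2[OF \<zeta>] coefficient_mult_L2[OF \<zeta>'] L2s)+
  have "cmod (prim ?f x) \<le> integral {x0..x} (\<lambda>t. B * h t + e * N)"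
  proof (rule norm_prim_le)
    show "AE t in M. cmod (?f t) \<le> B * h t + e * N"
      using AE_coefficient AE_\<psi> AE_d \<zeta>_near
    proof eventually_elim
      case (elim t)
      have "?f t = \<zeta>' t * D t + (\<zeta>' t - \<zeta> t) * \<psi> t" using elim(3) by (simp flip: elim(3)) (simp add: algebra_simps)
      then have "cmod (?f t) \<le> cmod (\<zeta>' t) * cmod (D t) + cmod (\<zeta>' t - \<zeta> t) * cmod (\<psi> t)"
        by (metis norm_mult norm_triangle_ineq)
      also have "\<dots> \<le> B * h t + e * N"
        using elim e B by (intro add_mono mult_mono) (auto simp: h_def)
      finally show ?case .
    qed
  qed (use x i in \<open>auto intro!: continuous_on_add continuous_on_mult continuous_on_const h_continuous\<close>)
  also have "\<dots> = B * integral {x0..x} h + e * N * (x - x0)"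
    by (rule integral_affine_h[OF x])
  also have "\<dots> \<le> B * integral {x0..x} h + e * N * len"
    using x e N by (intro add_left_mono mult_left_mono) auto
  finally have 1: "cmod (prim ?f x) \<le> B * integral {x0..x} h + e * N * len" .
  have "cmod ((rlim \<zeta>' x0 - rlim \<zeta> x0) * (2 - c) - rlim \<zeta>' x0 * (c' - c))
      \<le> cmod (rlim \<zeta>' x0 - rlim \<zeta> x0) * cmod (2 - c) + cmod (rlim \<zeta>' x0) * cmod (c' - c)"
    by (metis norm_mult norm_triangle_ineq4)
  also have "\<dots> \<le> e * N + B * cmod (c' - c)"
    using rlim_near c_le e B coefficient_limits(3)[OF \<zeta>'] by (intro add_mono mult_mono) auto
  finally have 2: "cmod ((rlim \<zeta>' x0 - rlim \<zeta> x0) * (2 - c) - rlim \<zeta>' x0 * (c' - c)) \<le> e * N + B * cmod (c' - c)" .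
  have pf: "prim ?f x = prim (\<lambda>t. \<zeta>' t * \<psi>' t) x - prim (\<lambda>t. \<zeta> t * \<psi> t) x"
    using x by (intro prim_diff i) auto
  have "q x = \<i> * of_real \<omega> * ((rlim \<zeta>' x0 - rlim \<zeta> x0) * (2 - c) - rlim \<zeta>' x0 * (c' - c)) - (of_real \<omega>)\<^sup>2 * prim ?f x"
    (is "_ = \<i> * of_real \<omega> * ?r - _") unfolding q_def flux_def pf by (simp add: algebra_simps)
  then have "cmod (q x) \<le> cmod (\<i> * of_real \<omega> * ?r) + cmod ((of_real \<omega>)\<^sup>2 * prim ?f x)"
    by (simp only: norm_triangle_ineq4)
  also have "\<dots> = \<bar>\<omega>\<bar> * cmod ?r + \<omega>\<^sup>2 * cmod (prim ?f x)"
    by (simp add: norm_mult norm_power)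
  also have "\<dots> \<le> \<bar>\<omega>\<bar> * (e * N + B * cmod (c' - c)) + \<omega>\<^sup>2 * (B * integral {x0..x} h + e * N * len)"
    using 1 2 by (intro add_mono mult_left_mono) auto
  finally show ?thesis .
qed

lemma h_growth:
  assumes x: "x \<in> {x0..x1}"
  shows "h x \<le> 2 * ((1 + \<bar>\<omega>\<bar> * B) * cmod (c' - c) + (len / m + \<bar>\<omega>\<bar> + \<omega>\<^sup>2 * len) * N * e) * exp (2 * (1 / m + \<omega>\<^sup>2 * B) * len)"
proof (rule Gronwall[OF h_continuous _ _ _ x])
  show "0 < 1 / m + \<omega>\<^sup>2 * B" using m B by (intro add_pos_nonneg) auto
  show "0 \<le> (1 + \<bar>\<omega>\<bar> * B) * cmod (c' - c) + (len / m + \<bar>\<omega>\<bar> + \<omega>\<^sup>2 * len) * N * e"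
    using m B N e x0_less_x1 by (intro add_nonneg_nonneg mult_nonneg_nonneg) auto
  show "h x \<le> (1 + \<bar>\<omega>\<bar> * B) * cmod (c' - c) + (len / m + \<bar>\<omega>\<bar> + \<omega>\<^sup>2 * len) * N * e + (1 / m + \<omega>\<^sup>2 * B) * integral {x0..x} h"
    if "x \<in> {x0..x1}" for x
    using D_le[OF that] q_le[OF that] unfolding h_def[of x] by (simp add: algebra_simps add_divide_distrib)
qed

section \<open>The energy estimate\<close>

lemma norm_integral_le:
  assumes "integrable M f" "AE x in M. cmod (f x) \<le> C"
  shows "cmod (LINT x|M. f x) \<le> C * len"
proof -
  have "cmod (prim f x1) \<le> integral {x0..x1} (\<lambda>_. C)" using assms by (intro norm_prim_le) auto
  then show ?thesis using x0_less_x1 assms(1) by (simp add: prim_x1 mult.commute)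
qed

lemma Im_form_zero:
  assumes f: "f \<in> L2 X" shows "Im (LINT x|M. \<zeta>' x * f x * cnj (f x)) = 0"
proof -
  have "Im (LINT x|M. \<zeta>' x * f x * cnj (f x)) = (LINT x|M. Im (\<zeta>' x * f x * cnj (f x)))"
    by (intro integral_Im[symmetric] coefficient_form_integrable[OF \<zeta>'] f)
  also have "\<dots> = 0"
  proof (rule integral_eq_zero_AE)
    show "AE x in M. Im (\<zeta>' x * f x * cnj (f x)) = 0"
      using AE_coefficient by eventually_elim (simp add: algebra_simps)
  qed
  finally show ?thesis .
qed

text \<open>Both weak equations are tested with \<open>d\<close> and subtracted. The right-hand
  sides differ too, as they contain \<open>rlim\<close> of the coefficient; together with the
  boundary term at \<open>x0\<close> this produces the factor \<open>2 - c\<close>.\<close>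

lemma energy_identity:
  defines "\<kappa> \<equiv> (1 - \<xi>) / (1 + \<xi>)"
  shows "\<omega> * (Re (rlim \<zeta>' x0) * (cmod (c' - c))\<^sup>2 + Re \<kappa> * Re (llim \<zeta>' x1) * (cmod (D x1))\<^sup>2)
     = Im (\<i> * of_real \<omega> * ((rlim \<zeta>' x0 - rlim \<zeta> x0) * (2 - c) * cnj (c' - c)
             - \<kappa> * (llim \<zeta>' x1 - llim \<zeta> x1) * (c + prim g x1) * cnj (D x1))
       - (of_real \<omega>)\<^sup>2 * (LINT x|M. (\<zeta>' x - \<zeta> x) * \<psi> x * cnj (d x)) + (LINT x|M. (\<zeta>' x - \<zeta> x) * g x * cnj (k x)))"
proof -
  define u where "u = c + prim g x1"
  define A where "A = (LINT x|M. \<zeta>' x * d x * cnj (d x))"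
  define K where "K = (LINT x|M. \<zeta>' x * k x * cnj (k x))"
  define R1 where "R1 = (LINT x|M. (\<zeta>' x - \<zeta> x) * \<psi> x * cnj (d x))"
  define R2 where "R2 = (LINT x|M. (\<zeta>' x - \<zeta> x) * g x * cnj (k x))"
  \<comment> \<open>Used once for the solutions and once for their derivatives: the primed
    coefficient goes to the difference, the coefficient error to the unprimed function.\<close>
  have split: "(LINT x|M. \<zeta>' x * f' x * cnj (f' x - f x)) = (LINT x|M. \<zeta> x * f x * cnj (f' x - f x))
      + (LINT x|M. \<zeta>' x * (f' x - f x) * cnj (f' x - f x)) + (LINT x|M. (\<zeta>' x - \<zeta> x) * f x * cnj (f' x - f x))"
    if f: "f \<in> L2 X" and f': "f' \<in> L2 X" for f f'
  proof -
    have i: "integrable M (\<lambda>x. \<zeta> x * f x * cnj (f' x - f x))"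
      "integrable M (\<lambda>x. \<zeta>' x * (f' x - f x) * cnj (f' x - f x))" "integrable M (\<lambda>x. \<zeta>' x * f x * cnj (f' x - f x))"
      by (intro coefficient_form_integrable[OF \<zeta>] coefficient_form_integrable[OF \<zeta>'] L2_diff f f')+
    have i': "integrable M (\<lambda>x. (\<zeta>' x - \<zeta> x) * f x * cnj (f' x - f x))"
      using Bochner_Integration.integrable_diff[OF i(3) i(1)] by (simp add: left_diff_distrib)
    have "(LINT x|M. \<zeta>' x * f' x * cnj (f' x - f x)) = (LINT x|M. \<zeta> x * f x * cnj (f' x - f x)
      + \<zeta>' x * (f' x - f x) * cnj (f' x - f x) + (\<zeta>' x - \<zeta> x) * f x * cnj (f' x - f x))"
      by (intro Bochner_Integration.integral_cong refl) (simp add: algebra_simps)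
    then show ?thesis
      by (simp only: Bochner_Integration.integral_add[OF Bochner_Integration.integrable_add[OF i(1,2)] i'] Bochner_Integration.integral_add[OF i(1,2)])
  qed
  have D1: "c' - c + prim k x1 = D x1" by (simp add: D_def)
  have u1: "c' + prim g' x1 = u + D x1"
    using prim_diff[of g' g x1] L2s by (simp add: u_def D_def L2_integrable)
  have cn: "cnj w * w = of_real ((cmod w)\<^sup>2)" for w by (simp only: complex_norm_square mult.commute)
  from weak_solution_test[OF w' \<zeta>' \<psi>' has_prim_d] weak_solution_test[OF w \<zeta> \<psi> has_prim_d]
  have "(of_real \<omega>)\<^sup>2 * A - K + \<i> * of_real \<omega> * (rlim \<zeta>' x0 * of_real ((cmod (c' - c))\<^sup>2) + \<kappa> * llim \<zeta>' x1 * of_real ((cmod (D x1))\<^sup>2))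
    = \<i> * of_real \<omega> * ((rlim \<zeta>' x0 - rlim \<zeta> x0) * (2 - c) * cnj (c' - c)
             - \<kappa> * (llim \<zeta>' x1 - llim \<zeta> x1) * u * cnj (D x1)) - (of_real \<omega>)\<^sup>2 * R1 + R2"
    unfolding D1 u1 \<kappa>_def[symmetric] u_def[symmetric] split[OF L2s(1,2)] split[OF L2s(3,4)]
       A_def[symmetric] K_def[symmetric] R1_def[symmetric] R2_def[symmetric] cn[symmetric]
    unfolding complex_cnj_diff by algebra
  then have "Im ((of_real \<omega>)\<^sup>2 * A - K + \<i> * of_real \<omega> * (rlim \<zeta>' x0 * of_real ((cmod (c' - c))\<^sup>2) + \<kappa> * llim \<zeta>' x1 * of_real ((cmod (D x1))\<^sup>2)))
    = Im (\<i> * of_real \<omega> * ((rlim \<zeta>' x0 - rlim \<zeta> x0) * (2 - c) * cnj (c' - c)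
             - \<kappa> * (llim \<zeta>' x1 - llim \<zeta> x1) * u * cnj (D x1)) - (of_real \<omega>)\<^sup>2 * R1 + R2)" by (rule arg_cong)
  moreover have "Im ((of_real \<omega>)\<^sup>2 * A - K + \<i> * of_real \<omega> * (rlim \<zeta>' x0 * of_real ((cmod (c' - c))\<^sup>2) + \<kappa> * llim \<zeta>' x1 * of_real ((cmod (D x1))\<^sup>2)))
    = \<omega> * (Re (rlim \<zeta>' x0) * (cmod (c' - c))\<^sup>2 + Re \<kappa> * Re (llim \<zeta>' x1) * (cmod (D x1))\<^sup>2)"
  proof -
    have im: "Im A = 0" "Im K = 0" unfolding A_def K_def by (intro Im_form_zero L2s)+
    have "Im ((of_real \<omega>)\<^sup>2 * A) = 0" by (simp add: im flip: of_real_power)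
    then show ?thesis using im coefficient_limits(1,4)[OF \<zeta>'] by (simp add: algebra_simps)
  qed
  ultimately show ?thesis unfolding R1_def R2_def u_def by simp
qed

lemma energy_bound:
  assumes S: "\<And>x. x \<in> {x0..x1} \<Longrightarrow> h x \<le> S"
  shows "\<bar>\<omega>\<bar> * m * (cmod (c' - c))\<^sup>2
     \<le> (\<omega>\<^sup>2 * len + len / m + \<bar>\<omega>\<bar> + \<bar>\<omega>\<bar> * cmod ((1 - \<xi>) / (1 + \<xi>))) * N * e * S + N\<^sup>2 * len / m * e\<^sup>2"
proof -
  define \<kappa> where "\<kappa> = (1 - \<xi>) / (1 + \<xi>)"
  define R1 where "R1 = (LINT x|M. (\<zeta>' x - \<zeta> x) * \<psi> x * cnj (d x))"
  define R2 where "R2 = (LINT x|M. (\<zeta>' x - \<zeta> x) * g x * cnj (k x))"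
  define P where "P = (rlim \<zeta>' x0 - rlim \<zeta> x0) * (2 - c) * cnj (c' - c)"
  define Q where "Q = \<kappa> * (llim \<zeta>' x1 - llim \<zeta> x1) * (c + prim g x1) * cnj (D x1)"
  have S0: "0 \<le> S" using S[of x0] x0_less_x1 by (auto simp: h_def intro: order_trans[OF add_nonneg_nonneg[OF norm_ge_zero norm_ge_zero]])
  have D_S: "cmod (D x) \<le> S" and q_S: "cmod (q x) \<le> S" if "x \<in> {x0..x1}" for x
    using S[OF that] norm_ge_zero[of "q x"] norm_ge_zero[of "D x"] unfolding h_def by linarith+
  have int: "integrable M (\<lambda>x. (\<zeta>' x - \<zeta> x) * f x * cnj (f' x))" if "f \<in> L2 X" "f' \<in> L2 X" for f f'
    using Bochner_Integration.integrable_diff[OF coefficient_form_integrable[OF \<zeta>' that] coefficient_form_integrable[OF \<zeta> that]]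
    by (simp add: left_diff_distrib)
  have R1: "cmod R1 \<le> e * N * S * len"
    unfolding R1_def
  proof (rule norm_integral_le)
    show "AE x in M. cmod ((\<zeta>' x - \<zeta> x) * \<psi> x * cnj (d x)) \<le> e * N * S"
      using \<zeta>_near AE_\<psi> AE_d AE_space
    proof eventually_elim
      case (elim x)
      then have "cmod (d x) \<le> S" using D_S[of x] by simp
      with elim show ?case unfolding norm_mult complex_mod_cnj using e N by (intro mult_mono) auto
    qed
  qed (intro int L2s)
  \<comment> \<open>The summand \<open>e * N\<close> that \<open>AE_k\<close> contributes here is
    the source of the term with \<open>e\<^sup>2\<close>.\<close>
  have R2: "cmod R2 \<le> e * N * ((S + e * N) / m) * len"
    unfolding R2_def
  proof (rule norm_integral_le)
    show "AE x in M. cmod ((\<zeta>' x - \<zeta> x) * g x * cnj (k x)) \<le> e * N * ((S + e * N) / m)"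
      using \<zeta>_near g_le AE_k AE_space
    proof eventually_elim
      case (elim x)
      have "(cmod (q x) + e * N) / m \<le> (S + e * N) / m" using m q_S[of x] elim(4) by (intro divide_right_mono) auto
      with elim have "cmod (k x) \<le> (S + e * N) / m" by linarith
      with elim show ?case unfolding norm_mult complex_mod_cnj using e N by (intro mult_mono) auto
    qed
  qed (intro int L2s)
  have P: "cmod P \<le> e * N * S"
    unfolding P_def norm_mult complex_mod_cnj using rlim_near c_le D_S[of x0] e N x0_less_x1
    by (intro mult_mono) (auto simp: D_def)
  have Q: "cmod Q \<le> cmod \<kappa> * e * N * S"
    unfolding Q_def norm_mult complex_mod_cnj using llim_near \<psi>_le[of x1] D_S[of x1] e N x0_less_x1
    by (intro mult_mono) auto
  have pos: "0 \<le> Re \<kappa> * Re (llim \<zeta>' x1) * (cmod (D x1))\<^sup>2"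
    using Re_impedance_pos[OF \<xi>] coefficient_limits(5)[OF \<zeta>'] m by (simp add: \<kappa>_def)
  have "\<bar>\<omega>\<bar> * m * (cmod (c' - c))\<^sup>2 = \<bar>\<omega>\<bar> * (m * (cmod (c' - c))\<^sup>2)" by simp
  \<comment> \<open>The contribution of \<open>x1\<close> is nonnegative and is merely added; the
    absolute value of \<open>\<omega>\<close> covers both signs of the frequency.\<close>
  also have "\<dots> \<le> \<bar>\<omega>\<bar> * (Re (rlim \<zeta>' x0) * (cmod (c' - c))\<^sup>2 + Re \<kappa> * Re (llim \<zeta>' x1) * (cmod (D x1))\<^sup>2)"
    using pos mult_right_mono[OF coefficient_limits(2)[OF \<zeta>'], of "(cmod (c' - c))\<^sup>2"] by (intro mult_left_mono) auto
  also have "\<dots> = \<bar>\<omega> * (Re (rlim \<zeta>' x0) * (cmod (c' - c))\<^sup>2 + Re \<kappa> * Re (llim \<zeta>' x1) * (cmod (D x1))\<^sup>2)\<bar>"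
    using pos coefficient_limits(2)[OF \<zeta>'] m by (simp add: abs_mult)
  also have "\<dots> = \<bar>Im (\<i> * of_real \<omega> * (P - Q) - (of_real \<omega>)\<^sup>2 * R1 + R2)\<bar>"
    using energy_identity unfolding P_def Q_def \<kappa>_def R1_def R2_def by simp
  also have "\<dots> \<le> cmod (\<i> * of_real \<omega> * (P - Q) - (of_real \<omega>)\<^sup>2 * R1 + R2)" by (rule abs_Im_le_cmod)
  also have "\<dots> \<le> cmod (\<i> * of_real \<omega> * (P - Q)) + cmod ((of_real \<omega>)\<^sup>2 * R1) + cmod R2"
    by (rule norm_triangle_le[OF add_right_mono[OF norm_triangle_ineq4]])
  also have "\<dots> = \<bar>\<omega>\<bar> * cmod (P - Q) + \<omega>\<^sup>2 * cmod R1 + cmod R2"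
    by (simp add: norm_mult norm_power)
  also have "\<dots> \<le> \<bar>\<omega>\<bar> * (e * N * S + cmod \<kappa> * e * N * S) + \<omega>\<^sup>2 * (e * N * S * len) + e * N * ((S + e * N) / m) * len"
    using P Q norm_triangle_ineq4[of P Q] R1 R2 by (intro add_mono mult_left_mono) auto
  also have "\<dots> = (\<omega>\<^sup>2 * len + len / m + \<bar>\<omega>\<bar> + \<bar>\<omega>\<bar> * cmod \<kappa>) * N * e * S + N\<^sup>2 * len / m * e\<^sup>2"
    by (simp add: algebra_simps add_divide_distrib power2_eq_square diff_divide_distrib)
  finally show ?thesis unfolding \<kappa>_def .
qed

lemma h_le:
  assumes x: "x \<in> {x0..x1}"
  shows "h x \<le> stability_constant \<omega> \<xi> m B N * e"
proof -
  define E where "E = exp (2 * (1 / m + \<omega>\<^sup>2 * B) * len)"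
  define \<alpha> where "\<alpha> = 2 * (1 + \<bar>\<omega>\<bar> * B) * E"
  define \<beta> where "\<beta> = 2 * (len / m + \<bar>\<omega>\<bar> + \<omega>\<^sup>2 * len) * N * E"
  define \<gamma> where "\<gamma> = (\<omega>\<^sup>2 * len + len / m + \<bar>\<omega>\<bar> + \<bar>\<omega>\<bar> * cmod ((1 - \<xi>) / (1 + \<xi>))) * N"
  define \<delta> where "\<delta> = N\<^sup>2 * len / m"
  define \<mu> where "\<mu> = \<bar>\<omega>\<bar> * m"
  have \<mu>: "0 < \<mu>" using \<omega> m by (simp add: \<mu>_def)
  have \<gamma>\<delta>: "0 \<le> \<gamma>" "0 \<le> \<delta>"
    using m N x0_less_x1 unfolding \<gamma>_def \<delta>_def by (auto intro!: add_nonneg_nonneg mult_nonneg_nonneg)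
  \<comment> \<open>At a maximum point \<open>y\<close>, the Gronwall bound for \<open>h y\<close>
    and the energy bound with \<open>S = h y\<close> close up into one quadratic inequality.\<close>
  obtain y where y: "y \<in> {x0..x1}" and max: "\<And>t. t \<in> {x0..x1} \<Longrightarrow> h t \<le> h y"
    using continuous_attains_sup[OF compact_Icc _ h_continuous] x by auto
  have h0: "0 \<le> h y" by (simp add: h_def)
  have "h y \<le> \<alpha> * cmod (c' - c) + \<beta> * e"
    using h_growth[OF y] unfolding \<alpha>_def \<beta>_def E_def by (simp add: algebra_simps)
  then have "(h y)\<^sup>2 \<le> (\<alpha> * cmod (c' - c) + \<beta> * e)\<^sup>2" using h0 by (intro power_mono) auto
  also have "\<dots> \<le> 2 * \<alpha>\<^sup>2 * (cmod (c' - c))\<^sup>2 + 2 * \<beta>\<^sup>2 * e\<^sup>2"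
    using sum_squares_bound[of "\<alpha> * cmod (c' - c)" "\<beta> * e"] by (simp add: power2_sum power_mult_distrib)
  also have "\<dots> \<le> 2 * \<alpha>\<^sup>2 * ((\<gamma> * e * h y + \<delta> * e\<^sup>2) / \<mu>) + 2 * \<beta>\<^sup>2 * e\<^sup>2"
  proof -
    have "\<mu> * (cmod (c' - c))\<^sup>2 \<le> \<gamma> * e * h y + \<delta> * e\<^sup>2"
      using energy_bound[OF max] unfolding \<mu>_def \<gamma>_def \<delta>_def by simp
    then have "(cmod (c' - c))\<^sup>2 \<le> (\<gamma> * e * h y + \<delta> * e\<^sup>2) / \<mu>"
      using \<mu> by (simp add: pos_le_divide_eq mult.commute)
    then show ?thesis by (intro add_right_mono mult_left_mono) auto
  qed
  also have "\<dots> = (2 * \<alpha>\<^sup>2 * \<gamma> / \<mu>) * e * h y + (2 * \<alpha>\<^sup>2 * \<delta> / \<mu> + 2 * \<beta>\<^sup>2) * e\<^sup>2"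
    by (simp add: algebra_simps add_divide_distrib)
  finally have "h y \<le> (2 * \<alpha>\<^sup>2 * \<gamma> / \<mu> + (2 * \<alpha>\<^sup>2 * \<delta> / \<mu> + 2 * \<beta>\<^sup>2) + 1) * e"
    using \<gamma>\<delta> \<mu> e h0 by (intro quadratic_bound) auto
  moreover have "stability_constant \<omega> \<xi> m B N = 2 * \<alpha>\<^sup>2 * \<gamma> / \<mu> + (2 * \<alpha>\<^sup>2 * \<delta> / \<mu> + 2 * \<beta>\<^sup>2) + 1"
    unfolding stability_constant_def Let_def \<alpha>_def \<beta>_def \<gamma>_def \<delta>_def \<mu>_def E_def by (rule refl)
  ultimately show ?thesis using max[OF x] by simp
qed

lemma stability:
  "AE x in M. cmod (d x) \<le> stability_constant \<omega> \<xi> m B N * e"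
  "AE x in M. cmod (k x) \<le> (stability_constant \<omega> \<xi> m B N + N) / m * e"
proof -
  let ?C = "stability_constant \<omega> \<xi> m B N"
  have le: "cmod (D x) \<le> ?C * e" "cmod (q x) \<le> ?C * e" if "x \<in> {x0..x1}" for x
    using h_le[OF that] norm_ge_zero[of "q x"] norm_ge_zero[of "D x"] unfolding h_def by linarith+
  show "AE x in M. cmod (d x) \<le> ?C * e"
    using AE_d AE_space by eventually_elim (use le in auto)
  show "AE x in M. cmod (k x) \<le> (?C + N) / m * e"
    using AE_k AE_space
  proof eventually_elim
    case (elim x)
    have "(cmod (q x) + e * N) / m \<le> (?C * e + e * N) / m"
      using le(2)[of x] elim(2) m by (intro divide_right_mono) auto
    also have "\<dots> = (?C + N) / m * e" by (simp add: algebra_simps)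
    finally show ?case using elim(1) by simp
  qed
qed

end

context bounded_interval begin

section \<open>Boundary conditions and convergence\<close>

lemma weak_solution_has_prim:
  assumes "weak_solution x0 x1 \<xi> \<omega> \<zeta> \<psi>"
  obtains c where "has_prim \<psi> c (wderiv X \<psi>)"
  using assms W12_has_prim unfolding weak_solution_def Let_def by blast

lemma weak_solution_wderiv:
  assumes w: "weak_solution x0 x1 \<xi> \<omega> \<zeta> \<psi>" and z: "coefficient m B \<zeta> (rlim \<zeta> x0) (llim \<zeta> x1)"
    and \<psi>: "has_prim \<psi> c (wderiv X \<psi>)"
  shows "AE x in M. wderiv X \<psi> x = flux \<omega> \<zeta> \<psi> c x / \<zeta> x"
proof -
  have "AE x in M. m \<le> Re (\<zeta> x)" "m > 0" using z by (auto simp: coefficient_def)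
  then have "AE x in M. \<zeta> x \<noteq> 0" by (auto elim!: eventually_mono)
  with weak_solution_flux(1)[OF w z \<psi>] show ?thesis by eventually_elim (simp add: field_simps)
qed

text \<open>A general Sobolev function has only a square integrable derivative. For a weak solution
  it is a continuous flux divided by a coefficient bounded below, hence essentially bounded.\<close>

lemma weak_solution_bounded:
  assumes w: "weak_solution x0 x1 \<xi> \<omega> \<zeta> \<psi>" and z: "coefficient m B \<zeta> (rlim \<zeta> x0) (llim \<zeta> x1)"
    and \<psi>: "has_prim \<psi> c (wderiv X \<psi>)"
  obtains N where "0 \<le> N" "cmod (2 - c) \<le> N" "\<And>x. x \<in> {x0..x1} \<Longrightarrow> cmod (c + prim (wderiv X \<psi>) x) \<le> N"
    "AE x in M. cmod (\<psi> x) \<le> N" "AE x in M. cmod (wderiv X \<psi> x) \<le> N"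
proof -
  have L2: "\<psi> \<in> L2 X" "wderiv X \<psi> \<in> L2 X" using has_prim_L2[OF \<psi>] \<psi> by (auto simp: has_prim_def)
  have "continuous_on {x0..x1} (\<lambda>x. c + prim (wderiv X \<psi>) x)" by (intro affine_prim_continuous L2_integrable L2)
  then obtain U where U: "\<And>x. x \<in> {x0..x1} \<Longrightarrow> cmod (c + prim (wderiv X \<psi>) x) \<le> U"
    using continuous_bounded by blast
  obtain F where F: "\<And>x. x \<in> {x0..x1} \<Longrightarrow> cmod (flux \<omega> \<zeta> \<psi> c x) \<le> F"
    using continuous_bounded[OF flux_continuous[OF z L2(1)]] by blast
  have m: "0 < m" and ae: "AE x in M. Im (\<zeta> x) = 0 \<and> m \<le> Re (\<zeta> x) \<and> cmod (\<zeta> x) \<le> B" using z by (auto simp: coefficient_def)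
  define N where "N = max U (max (F / m) (cmod (2 - c)))"
  have "AE x in M. cmod (\<psi> x) \<le> N"
  proof -
    have "AE x in M. \<psi> x = c + prim (wderiv X \<psi>) x" using \<psi> by (simp add: has_prim_def)
    then show ?thesis using AE_space by eventually_elim (use U in \<open>auto simp: N_def le_max_iff_disj\<close>)
  qed
  moreover have "AE x in M. cmod (wderiv X \<psi> x) \<le> N"
    using weak_solution_wderiv[OF w z \<psi>] ae AE_space
  proof eventually_elim
    case (elim x)
    have "m \<le> cmod (\<zeta> x)" using elim complex_Re_le_cmod order_trans by blast
    then have "cmod (flux \<omega> \<zeta> \<psi> c x) / cmod (\<zeta> x) \<le> F / m"
      using F[of x] elim m by (intro frac_le order_trans[OF norm_ge_zero F]) auto
    then show ?case using elim(1) by (simp add: norm_divide N_def)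
  qed
  moreover have "0 \<le> N" using norm_ge_zero[of "2 - c"] unfolding N_def by linarith
  moreover have "cmod (2 - c) \<le> N" "\<And>x. x \<in> {x0..x1} \<Longrightarrow> cmod (c + prim (wderiv X \<psi>) x) \<le> N"
    using U by (auto simp: N_def le_max_iff_disj)
  ultimately show ?thesis using that by blast
qed

lemma weak_solution_boundary_conditions:
  assumes \<omega>: "\<omega> \<noteq> 0" and \<xi>: "cmod \<xi> < 1"
    and w: "weak_solution x0 x1 \<xi> \<omega> \<zeta> \<psi>" and z: "coefficient m B \<zeta> (rlim \<zeta> x0) (llim \<zeta> x1)"
  shows "boundary_conditions x0 x1 \<xi> \<omega> \<psi>"
proof -
  obtain c where \<psi>: "has_prim \<psi> c (wderiv X \<psi>)" using weak_solution_has_prim[OF w] .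
  define u where "u = c + prim (wderiv X \<psi>) x1"
  define \<kappa> where "\<kappa> = (1 - \<xi>) / (1 + \<xi>)"
  have L2: "\<psi> \<in> L2 X" using has_prim_L2[OF \<psi>] .
  note cf = flux_continuous[OF z L2, of \<omega> c]
  have z0: "rlim \<zeta> x0 \<noteq> 0" "llim \<zeta> x1 \<noteq> 0" using coefficient_limits(7,8)[OF z] by auto
  have zl: "(\<zeta> \<longlongrightarrow> rlim \<zeta> x0) left_end" "(\<zeta> \<longlongrightarrow> llim \<zeta> x1) right_end" using z by (auto simp: coefficient_def)
  note ae = weak_solution_wderiv[OF w z \<psi>]
  have "((\<lambda>x. flux \<omega> \<zeta> \<psi> c x / \<zeta> x) \<longlongrightarrow> flux \<omega> \<zeta> \<psi> c x0 / rlim \<zeta> x0) left_end"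
    by (intro tendsto_divide continuous_left_end cf zl z0)
  also have "flux \<omega> \<zeta> \<psi> c x0 / rlim \<zeta> x0 = \<i> * of_real \<omega> * (2 - c)" using z0 by (simp add: flux_def)
  finally have left: "(wderiv X \<psi> \<longlongrightarrow> \<i> * of_real \<omega> * (2 - c)) left_end"
    using tendsto_cong[OF AE_imp_left_end[OF ae]] by blast
  have "((\<lambda>x. flux \<omega> \<zeta> \<psi> c x / \<zeta> x) \<longlongrightarrow> flux \<omega> \<zeta> \<psi> c x1 / llim \<zeta> x1) right_end"
    by (intro tendsto_divide continuous_right_end cf zl z0)
  also have "flux \<omega> \<zeta> \<psi> c x1 / llim \<zeta> x1 = \<i> * of_real \<omega> * \<kappa> * u"
    using z0 weak_solution_flux(2)[OF w z \<psi>] by (simp add: \<kappa>_def u_def)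
  finally have right: "(wderiv X \<psi> \<longlongrightarrow> \<i> * of_real \<omega> * \<kappa> * u) right_end"
    using tendsto_cong[OF AE_imp_right_end[OF ae]] by blast
  have iw: "\<i> * complex_of_real \<omega> \<noteq> 0" using \<omega> by simp
  have "(right_part X \<omega> \<psi> \<longlongrightarrow> (c + 1 / (\<i> * of_real \<omega>) * (\<i> * of_real \<omega> * (2 - c))) / 2) left_end"
    unfolding right_part_def by (intro tendsto_intros has_prim_limits(1)[OF \<psi>] left) simp
  also have "(c + 1 / (\<i> * of_real \<omega>) * (\<i> * of_real \<omega> * (2 - c))) / 2 = 1" using iw by (simp add: field_simps)
  finally have bc0: "(right_part X \<omega> \<psi> \<longlongrightarrow> 1) left_end" .
  have r: "(right_part X \<omega> \<psi> \<longlongrightarrow> (u + 1 / (\<i> * of_real \<omega>) * (\<i> * of_real \<omega> * \<kappa> * u)) / 2) right_end"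
    unfolding right_part_def u_def by (intro tendsto_intros has_prim_limits(2)[OF \<psi>] right[unfolded u_def]) simp
  have l: "(left_part X \<omega> \<psi> \<longlongrightarrow> (u - 1 / (\<i> * of_real \<omega>) * (\<i> * of_real \<omega> * \<kappa> * u)) / 2) right_end"
    unfolding left_part_def u_def by (intro tendsto_intros has_prim_limits(2)[OF \<psi>] right[unfolded u_def]) simp
  have "1 + \<xi> \<noteq> 0"
    using Re_impedance_pos[OF \<xi>] by auto
  \<comment> \<open>The inverse Cayley transform: the impedance \<open>\<kappa>\<close> has the
    reflection coefficient \<open>\<xi>\<close>.\<close>
  then have "1 - \<kappa> = \<xi> * (1 + \<kappa>)" by (simp add: \<kappa>_def field_simps)
  then have "u - \<kappa> * u = \<xi> * (u + \<kappa> * u)" by (metis mult.assoc mult_1 left_diff_distrib distrib_right)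
  then have "(u - 1 / (\<i> * of_real \<omega>) * (\<i> * of_real \<omega> * \<kappa> * u)) / 2 = \<xi> * ((u + 1 / (\<i> * of_real \<omega>) * (\<i> * of_real \<omega> * \<kappa> * u)) / 2)"
    using iw by simp
  with r l bc0 show ?thesis unfolding boundary_conditions_def Let_def by metis
qed

lemma weak_solutions_converge:
  assumes \<omega>: "\<omega> \<noteq> 0" and \<xi>: "cmod \<xi> < 1"
    and \<zeta>: "\<zeta> \<in> Reg_pos X" and \<zeta>s: "\<And>n. \<zeta>s n \<in> Reg_pos X"
    and w: "weak_solution x0 x1 \<xi> \<omega> \<zeta> \<psi>" and ws: "\<And>n. weak_solution x0 x1 \<xi> \<omega> (\<zeta>s n) (\<psi>s n)"
    and lim: "tendsto_Linf X \<zeta>s \<zeta>" and r: "0 < r"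
  shows "\<forall>\<^sub>F n in sequentially. (AE x in M. cmod (\<psi>s n x - \<psi> x) \<le> r) \<and>
     (AE x in M. cmod (wderiv X (\<psi>s n) x - wderiv X \<psi> x) \<le> r)"
proof -
  obtain m B where z: "coefficient m B \<zeta> (rlim \<zeta> x0) (llim \<zeta> x1)" using Reg_pos_coefficient[OF \<zeta>] .
  obtain c where \<psi>: "has_prim \<psi> c (wderiv X \<psi>)" using weak_solution_has_prim[OF w] .
  obtain N where N: "0 \<le> N" "cmod (2 - c) \<le> N" "\<And>x. x \<in> {x0..x1} \<Longrightarrow> cmod (c + prim (wderiv X \<psi>) x) \<le> N"
    "AE x in M. cmod (\<psi> x) \<le> N" "AE x in M. cmod (wderiv X \<psi> x) \<le> N"
    using weak_solution_bounded[OF w z \<psi>] by blast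
  have m: "0 < m" using z by (simp add: coefficient_def)
  define C where "C = stability_constant \<omega> \<xi> (m / 2) (B + m) N"
  define T where "T = max C ((C + N) / (m / 2))"
  \<comment> \<open>\<open>m / 2\<close> is the threshold of \<open>coefficient_perturb\<close>. The
    sign of \<open>T\<close> is left open, so \<open>\<bar>T\<bar> + 1\<close> serves as a positive
    denominator.\<close>
  define e where "e = min (m / 2) (r / (\<bar>T\<bar> + 1))"
  have "0 < e" using m r by (simp add: e_def)
  moreover have "e \<le> m / 2" "e \<le> r / (\<bar>T\<bar> + 1)" unfolding e_def by (rule min.cobounded1, rule min.cobounded2)
  ultimately have e: "0 < e" "e \<le> m / 2" "e \<le> r / (\<bar>T\<bar> + 1)" .
  have "T * e \<le> (\<bar>T\<bar> + 1) * (r / (\<bar>T\<bar> + 1))"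
    using e by (intro mult_mono) auto
  then have Te: "T * e \<le> r" by simp
  have "C \<le> T" "(C + N) / (m / 2) \<le> T"
    unfolding T_def by (rule max.cobounded1, rule max.cobounded2)
  from this[THEN mult_right_mono, of e] Te e(1) have le: "C * e \<le> r" "(C + N) / (m / 2) * e \<le> r" by linarith+
  have z': "coefficient (m / 2) (B + m) \<zeta> (rlim \<zeta> x0) (llim \<zeta> x1)"
    using m by (intro coefficient_mono[OF z]) auto
  show ?thesis using tendsto_LinfD[OF lim e(1)]
  proof eventually_elim
    case (elim n)
    then have near: "AE x in M. cmod (\<zeta>s n x - \<zeta> x) \<le> e" by (auto elim: eventually_mono)
    obtain m' B' where zn: "coefficient m' B' (\<zeta>s n) (rlim (\<zeta>s n) x0) (llim (\<zeta>s n) x1)"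
      using Reg_pos_coefficient[OF \<zeta>s] .
    obtain c' where \<psi>': "has_prim (\<psi>s n) c' (wderiv X (\<psi>s n))" using weak_solution_has_prim[OF ws] .
    interpret two_solutions x0 x1 \<omega> "m / 2" "B + m" N e \<xi> \<zeta> "\<zeta>s n" \<psi> "\<psi>s n" "wderiv X \<psi>" "wderiv X (\<psi>s n)" c c'
      by unfold_locales (use \<omega> \<xi> e N w ws z' \<psi> \<psi>' near coefficient_perturb[OF z zn near e(2)] in auto)
    note st = stability[folded C_def]
    show ?case
    proof
      show "AE x in M. cmod (\<psi>s n x - \<psi> x) \<le> r"
        using st(1) by eventually_elim (use le(1) in linarith)
      show "AE x in M. cmod (wderiv X (\<psi>s n) x - wderiv X \<psi> x) \<le> r"
        using st(2) by eventually_elim (use le(2) in linarith)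
    qed
  qed
qed

section \<open>From essential bounds to convergence in norm\<close>

lemma norm_L2_le:
  assumes f: "f \<in> borel_measurable M" and le: "AE x in M. cmod (f x) \<le> r" and r: "0 \<le> r"
  shows "norm_L2 X f \<le> r * sqrt (x1 - x0)"
proof -
  have "(LINT x|M. (cmod (f x))\<^sup>2) \<le> (LINT x|M. r\<^sup>2)"
  proof (rule integral_mono_AE)
    show "integrable M (\<lambda>x. (cmod (f x))\<^sup>2)" by (rule L2_square[OF bounded_L2[OF f le]])
    show "AE x in M. (cmod (f x))\<^sup>2 \<le> r\<^sup>2" using le by eventually_elim (auto intro: power_mono)
  qed simp
  also have "\<dots> = r\<^sup>2 * (x1 - x0)" using x0_less_x1 by (simp add: measure_restrict_space)
  finally have "norm_L2 X f \<le> sqrt (r\<^sup>2 * (x1 - x0))" unfolding norm_L2_def by (rule real_sqrt_le_mono)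
  then show ?thesis using r by (simp add: real_sqrt_mult)
qed

lemma norm_W12_le:
  assumes u: "has_prim u c (wderiv X u)" and v: "has_prim v d (wderiv X v)" and r: "0 \<le> r"
    and le: "AE x in M. cmod (u x - v x) \<le> r" "AE x in M. cmod (wderiv X u x - wderiv X v x) \<le> r"
  shows "norm_W12 X (\<lambda>x. u x - v x) \<le> 2 * r * sqrt (x1 - x0)"
proof -
  note d = has_prim_diff[OF u v]
  have "norm_L2 X (\<lambda>x. u x - v x) \<le> r * sqrt (x1 - x0)"
    using d by (intro norm_L2_le le r) (simp add: has_prim_def)
  moreover have "norm_L2 X (wderiv X (\<lambda>x. u x - v x)) \<le> r * sqrt (x1 - x0)"
  proof (rule norm_L2_le)
    show "wderiv X (\<lambda>x. u x - v x) \<in> borel_measurable M"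
      using has_prim_wderiv(1)[OF d] by (auto simp: has_prim_def L2_measurable)
    show "AE x in M. cmod (wderiv X (\<lambda>x. u x - v x) x) \<le> r"
      using has_prim_wderiv(2)[OF d] le(2) by eventually_elim simp
  qed (rule r)
  moreover have "0 \<le> norm_L2 X f" for f unfolding norm_L2_def by (simp add: integral_nonneg_AE)
  then have "norm_W12 X (\<lambda>x. u x - v x) \<le> norm_L2 X (\<lambda>x. u x - v x) + norm_L2 X (wderiv X (\<lambda>x. u x - v x))"
    unfolding norm_W12_def by (intro sqrt_sum_squares_le_sum)
  ultimately show ?thesis by simp
qed

text \<open>Serves the left-going and the right-going part at once; they differ only in the sign of
  \<open>b\<close>.\<close>

lemma tendsto_Linf_combination:
  fixes a b :: complex
  assumes u: "\<And>n. u n \<in> Linf X" "v \<in> Linf X" and u': "\<And>n. u' n \<in> Linf X" "v' \<in> Linf X"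
    and lim: "\<And>r. 0 < r \<Longrightarrow> \<forall>\<^sub>F n in sequentially. (AE x in M. cmod (u n x - v x) \<le> r) \<and> (AE x in M. cmod (u' n x - v' x) \<le> r)"
  shows "tendsto_Linf X (\<lambda>n x. a * u n x + b * u' n x) (\<lambda>x. a * v x + b * v' x)"
proof (rule tendsto_LinfI)
  have comb: "(\<lambda>x. a * f x + b * f' x) \<in> Linf X" if f: "f \<in> Linf X" "f' \<in> Linf X" for f f'
  proof -
    obtain F F' where F: "AE x in M. cmod (f x) \<le> F" "AE x in M. cmod (f' x) \<le> F'"
      using Linf_bounded f by metis
    have "AE x in M. cmod (a * f x + b * f' x) \<le> cmod a * F + cmod b * F'"
      using F by eventually_elim (auto simp: norm_mult intro!: norm_triangle_le add_mono mult_left_mono)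
    then show ?thesis using f[THEN Linf_measurable] by (intro LinfI) auto
  qed
  show "(\<lambda>x. a * u n x + b * u' n x) \<in> Linf X" for n by (intro comb u u')
  show "(\<lambda>x. a * v x + b * v' x) \<in> Linf X" by (intro comb u u')
  fix r :: real assume r: "0 < r"
  define s where "s = r / (cmod a + cmod b + 1)"
  have pos: "0 < cmod a + cmod b + 1" using norm_ge_zero[of a] norm_ge_zero[of b] by linarith
  have s: "0 < s" "(cmod a + cmod b) * s \<le> r"
  proof -
    show "0 < s" using r pos by (simp add: s_def)
    then have "(cmod a + cmod b) * s \<le> (cmod a + cmod b + 1) * s" by (intro mult_right_mono) auto
    also have "\<dots> = r" using pos by (simp add: s_def)
    finally show "(cmod a + cmod b) * s \<le> r" .
  qed
  show "\<forall>\<^sub>F n in sequentially. AE x in M. cmod (a * u n x + b * u' n x - (a * v x + b * v' x)) \<le> r"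
    using lim[OF s(1)]
  proof eventually_elim
    case (elim n)
    then have "AE x in M. cmod (u n x - v x) \<le> s" "AE x in M. cmod (u' n x - v' x) \<le> s" by auto
    then show ?case
    proof eventually_elim
      case (elim x)
      have "a * u n x + b * u' n x - (a * v x + b * v' x) = a * (u n x - v x) + b * (u' n x - v' x)"
        by (simp add: algebra_simps)
      also have "cmod \<dots> \<le> cmod a * s + cmod b * s"
        using elim by (auto simp: norm_mult intro!: norm_triangle_le add_mono mult_left_mono)
      finally show ?case using s(2) by (simp add: algebra_simps)
    qed
  qed
qed

end

theorem lemma1:
  fixes x0 x1 \<omega> :: real and \<xi> :: complex and X :: "real set"
    and \<zeta> \<psi> :: "real \<Rightarrow> complex" and \<zeta>s \<psi>s :: "nat \<Rightarrow> real \<Rightarrow> complex"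
  assumes "x0 < x1" and "X = {x0<..<x1}"
    and "\<xi> \<in> ball 0 1"
    and "\<zeta> \<in> Reg_pos X" and "\<And>n. \<zeta>s n \<in> Reg_pos X"
    and "\<omega> \<notin> exceptional_set X \<zeta> \<union> (\<Union>n. exceptional_set X (\<zeta>s n))"
    and "weak_solution x0 x1 \<xi> \<omega> \<zeta> \<psi>"
    and "\<And>n. weak_solution x0 x1 \<xi> \<omega> (\<zeta>s n) (\<psi>s n)"
    and "tendsto_Linf X \<zeta>s \<zeta>"
  shows "tendsto_W12 X \<psi>s \<psi> \<and>
    ((\<forall>n. boundary_conditions x0 x1 \<xi> \<omega> (\<psi>s n)) \<longrightarrow>
       boundary_conditions x0 x1 \<xi> \<omega> \<psi> \<and>
       tendsto_Linf X (\<lambda>n. left_part X \<omega> (\<psi>s n)) (left_part X \<omega> \<psi>) \<and>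
       tendsto_Linf X (\<lambda>n. right_part X \<omega> (\<psi>s n)) (right_part X \<omega> \<psi>))"
proof -
  interpret bounded_interval x0 x1 by unfold_locales fact
  let ?M = "lebesgue_on {x0<..<x1}"
  have \<xi>: "cmod \<xi> < 1" using assms(3) by simp
  have \<zeta>: "\<zeta> \<in> Reg_pos {x0<..<x1}" and \<zeta>s: "\<And>n. \<zeta>s n \<in> Reg_pos {x0<..<x1}" using assms(2,4,5) by auto
  have lim: "tendsto_Linf {x0<..<x1} \<zeta>s \<zeta>" using assms(2,9) by simp
  note w = assms(7) and ws = assms(8)
  obtain m B where z: "coefficient m B \<zeta> (rlim \<zeta> x0) (llim \<zeta> x1)" using Reg_pos_coefficient[OF \<zeta>] .
  have \<omega>: "\<omega> \<noteq> 0" using zero_in_exceptional_set[OF z] assms(2,6) by auto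
  note conv = weak_solutions_converge[OF \<omega> \<xi> \<zeta> \<zeta>s w ws lim]
  obtain c where \<psi>: "has_prim \<psi> c (wderiv X \<psi>)" using weak_solution_has_prim[OF w] assms(2) by blast
  have "\<exists>c. has_prim (\<psi>s n) c (wderiv X (\<psi>s n))" for n using weak_solution_has_prim[OF ws] assms(2) by blast
  then obtain cs where \<psi>s: "\<And>n. has_prim (\<psi>s n) (cs n) (wderiv X (\<psi>s n))" by metis
  have "(\<lambda>n. norm_W12 X (\<lambda>x. \<psi>s n x - \<psi> x)) \<longlonglongrightarrow> 0"
  proof (rule tendstoI)
    fix r :: real assume r: "0 < r"
    \<comment> \<open>The added 1 keeps the denominator positive and makes the resulting inequality
      strict.\<close>
    define s where "s = r / (2 * sqrt (x1 - x0) + 1)"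
    have pos: "0 < 2 * sqrt (x1 - x0) + 1" using assms(1) by (intro add_nonneg_pos) auto
    have s: "0 < s" "2 * s * sqrt (x1 - x0) < r"
    proof -
      show "0 < s" using r pos by (simp add: s_def)
      then have "2 * s * sqrt (x1 - x0) < (2 * sqrt (x1 - x0) + 1) * s" by (simp add: algebra_simps)
      also have "\<dots> = r" using pos by (simp add: s_def)
      finally show "2 * s * sqrt (x1 - x0) < r" .
    qed
    show "\<forall>\<^sub>F n in sequentially. dist (norm_W12 X (\<lambda>x. \<psi>s n x - \<psi> x)) 0 < r"
      using conv[OF s(1)]
    proof eventually_elim
      case (elim n)
      have "norm_W12 X (\<lambda>x. \<psi>s n x - \<psi> x) \<le> 2 * s * sqrt (x1 - x0)"
        unfolding assms(2) using elim s(1) \<psi>s[of n] \<psi> by (intro norm_W12_le) (auto simp: assms(2))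
      moreover have "0 \<le> norm_W12 X (\<lambda>x. \<psi>s n x - \<psi> x)" by (simp add: norm_W12_def)
      ultimately show ?case using s(2) by (simp add: dist_real_def)
    qed
  qed
  then have W12: "tendsto_W12 X \<psi>s \<psi>"
    using w ws assms(2) unfolding tendsto_W12_def weak_solution_def Let_def by blast
  \<comment> \<open>Membership in \<open>Linf\<close> is part of \<open>tendsto_Linf\<close>, so
    each solution and its derivative must be shown essentially bounded, without uniformity in
    \<open>n\<close>.\<close>
  have bounded: "u \<in> Linf X" "wderiv X u \<in> Linf X"
    if zw: "z \<in> Reg_pos X" "weak_solution x0 x1 \<xi> \<omega> z u" "has_prim u d (wderiv X u)" for z u d
  proof -
    obtain m B where z: "coefficient m B z (rlim z x0) (llim z x1)" using Reg_pos_coefficient zw(1) assms(2) by blast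
    obtain N where "AE x in ?M. cmod (u x) \<le> N" "AE x in ?M. cmod (wderiv {x0<..<x1} u x) \<le> N"
      using weak_solution_bounded[OF zw(2) z] zw(3) assms(2) by blast
    then show "u \<in> Linf X" "wderiv X u \<in> Linf X"
      using zw(3) L2_measurable unfolding assms(2) by (auto simp: has_prim_def intro: LinfI)
  qed
  have lin: "tendsto_Linf X (\<lambda>n x. a * \<psi>s n x + b * wderiv X (\<psi>s n) x) (\<lambda>x. a * \<psi> x + b * wderiv X \<psi> x)" for a b
    using bounded[OF assms(4) w \<psi>] bounded[OF assms(5) ws \<psi>s] conv
    unfolding assms(2) by (intro tendsto_Linf_combination) auto
  have parts: "left_part X \<omega> u = (\<lambda>x. (1 / 2) * u x + (- 1 / (2 * \<i> * of_real \<omega>)) * wderiv X u x)"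
    "right_part X \<omega> u = (\<lambda>x. (1 / 2) * u x + (1 / (2 * \<i> * of_real \<omega>)) * wderiv X u x)" for u
    by (auto simp: fun_eq_iff left_part_def right_part_def diff_divide_distrib add_divide_distrib)
  have "tendsto_Linf X (\<lambda>n. left_part X \<omega> (\<psi>s n)) (left_part X \<omega> \<psi>)"
     "tendsto_Linf X (\<lambda>n. right_part X \<omega> (\<psi>s n)) (right_part X \<omega> \<psi>)"
    unfolding parts by (rule lin)+
  then show ?thesis using W12 weak_solution_boundary_conditions[OF \<omega> \<xi> w z] by blast
qed

end
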